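(* Let $X$ be a finite lattice-convex subset of $\mathbb{Z}^d$ satisfying one of the following conditions: (a) The points in $X$ represent every residue class in $(\mathbb{Z}/2\mathbb{Z})^d$. (b) The polytope $\operatorname{conv}(X)$ contains interior lattice points, i.e., $\operatorname{int}(\operatorname{conv}(X)) \cap \mathbb{Z}^d \neq \emptyset$. (c) The lattice-width of $X$ is bigger than the finiteness threshold width $w^\infty(d)$. Then $\operatorname{rc}(X)$ and $\operatorname{rc}_{\mathbb{Q}}(X)$ coincide and can be computed algorithmically (i.e., there is an algorithm that, given such an $X$ as input, outputs this number).
   Context: A set $X \subseteq \mathbb{Z}^d$ is lattice-convex if $\operatorname{conv}(X) \cap \mathbb{Z}^d = X$. We say $X$ is described by $k$ linear inequalities within $\mathbb{Z}^d$ if $X = \{x \in \mathbb{Z}^d : Ax \le b,\ Ux = v\}$ for some real matrices $A, U$ and real vectors $b, v$, where $Ax \le b$ consists of $k$ inequalities (the number of equations $Ux=v$ is arbitrary and not counted); if all entries of $A,U,b,v$ can be taken rational, $X$ is described by $k$ rational linear inequalities within $\mathbb{Z}^d$. The relaxation complexity $\operatorname{rc}(X)$ (resp. $\operatorname{rc}_{\mathbb{Q}}(X)$) is the minimal $k$ such that $X$ can be described by $k$ linear inequalities (resp. $k$ rational linear inequalities) within $\mathbb{Z}^d$. For $u \in \mathbb{Z}^d\setminus\{0\}$ and $S \subseteq \mathbb{R}^d$ let $w(S,u) = \max_{x\in S} u^\intercal x - \min_{x \in S} u^\intercal x$; the lattice-width of $S$ is $w(S) = \min_{u \in \mathbb{Z}^d\setminus\{0\}}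 w(S,u)$. A lattice polytope is the convex hull of finitely many points of $\mathbb{Z}^d$. Two sets in $\mathbb{R}^d$ are unimodularly equivalent if one is the image of the other under a map $x \mapsto Ux+t$ with $U$ an integral $d\times d$ matrix of determinant $\pm1$ and $t \in \mathbb{Z}^d$. The finiteness threshold width $w^\infty(d)$ is the smallest non-negative integer such that for every positive integer $n$, up to unimodular equivalence, all but finitely many $d$-dimensional lattice polytopes in $\mathbb{R}^d$ with exactly $n$ lattice points have lattice-width at most $w^\infty(d)$ (this is a finite constant). *)

theory Defs
  imports
    "HOL-Analysis.Analysis"
    "HOL-Library.Function_Algebras"
    "HOL-Library.Extended_Nat"
    "HOL-Library.Nat_Bijection"
    "Jordan_Normal_Form.Determinant"
begin

text \<open>
  The dimension \<open>d\<close> has to be a term, because a single algorithm is to serve all dimensions.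
  Hence \<open>\<real>\<^sup>d\<close> is the library's \<^const>\<open>Euclidean_space\<close>, the space of functions
  \<open>x :: nat \<Rightarrow> real\<close> with \<open>x i = 0\<close> for all \<open>i \<ge> d\<close>. The pointwise
  vector space structure below makes \<open>convex hull\<close> and \<open>affine hull\<close> available.
\<close>

instantiation "fun" :: (type, real_vector) real_vector
begin

definition scaleR_fun :: "real \<Rightarrow> ('a \<Rightarrow> 'b) \<Rightarrow> 'a \<Rightarrow> 'b"
  where "scaleR_fun c f = (\<lambda>x. c *\<^sub>R f x)"

instance
  by standard (simp_all add: scaleR_fun_def plus_fun_def scaleR_add_right scaleR_add_left)

end

type_synonym point = "nat \<Rightarrow> real"

definition int_lattice :: "nat \<Rightarrow> point set"
  where "int_lattice d = {x \<in> topspace (Euclidean_space d). \<forall>i. x i \<in> \<int>}"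

definition dotp :: "nat \<Rightarrow> point \<Rightarrow> point \<Rightarrow> real"
  where "dotp d u x = (\<Sum>i<d. u i * x i)"

definition lattice_convex :: "nat \<Rightarrow> point set \<Rightarrow> bool"
  where "lattice_convex d X \<longleftrightarrow> convex hull X \<inter> int_lattice d = X"


subsection \<open>Relaxation complexity\<close>

text \<open>
  The rows of \<open>A\<close> and \<open>U\<close> are \<open>A i\<close> and \<open>U i\<close>; only the entries with row index below
  \<open>k\<close> resp. \<open>m\<close> and column index below \<open>d\<close> matter. \<open>K\<close> is the set of admissible entries.
\<close>

definition described_by :: "real set \<Rightarrow> nat \<Rightarrow> nat \<Rightarrow> point set \<Rightarrow> bool"
  where "described_by K d k X \<longleftrightarrow>
    (\<exists>m (A :: nat \<Rightarrow> point) (b :: nat \<Rightarrow> real) (U :: nat \<Rightarrow> point) (v :: nat \<Rightarrow> real).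
       (\<forall>i<k. b i \<in> K \<and> (\<forall>j<d. A i j \<in> K)) \<and>
       (\<forall>i<m. v i \<in> K \<and> (\<forall>j<d. U i j \<in> K)) \<and>
       X = {x \<in> int_lattice d. (\<forall>i<k. dotp d (A i) x \<le> b i) \<and> (\<forall>i<m. dotp d (U i) x = v i)})"

text \<open>Both numbers are \<open>\<infinity>\<close> for sets without a description.\<close>

definition rc :: "nat \<Rightarrow> point set \<Rightarrow> enat"
  where "rc d X = Inf {enat k | k. described_by UNIV d k X}"

definition rc_rat :: "nat \<Rightarrow> point set \<Rightarrow> enat"
  where "rc_rat d X = Inf {enat k | k. described_by \<rat> d k X}"


subsection \<open>Lattice-width and the finiteness threshold width\<close>

text \<open>
  For nonempty compact \<open>S\<close> the supremum and the two infima are attained (the last one if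
  \<open>d \<ge> 1\<close>); for empty \<open>S\<close> or \<open>d = 0\<close> the value is meaningless.
\<close>

definition width_along :: "nat \<Rightarrow> point set \<Rightarrow> point \<Rightarrow> real"
  where "width_along d S u = Sup (dotp d u ` S) - Inf (dotp d u ` S)"

definition lattice_width :: "nat \<Rightarrow> point set \<Rightarrow> real"
  where "lattice_width d S = Inf (width_along d S ` (int_lattice d - {0}))"

definition lattice_polytope :: "nat \<Rightarrow> point set \<Rightarrow> bool"
  where "lattice_polytope d P \<longleftrightarrow> (\<exists>V. finite V \<and> V \<subseteq> int_lattice d \<and> P = convex hull V)"

definition full_dimensional :: "nat \<Rightarrow> point set \<Rightarrow> bool"
  where "full_dimensional d P \<longleftrightarrow> affine hull P = topspace (Euclidean_space d)"

definition affine_map :: "nat \<Rightarrow> int mat \<Rightarrow> point \<Rightarrow> point \<Rightarrow> point"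
  where "affine_map d U t x = (\<lambda>i. if i < d then (\<Sum>j<d. of_int (U $$ (i, j)) * x j) + t i else 0)"

definition unimodular_rel :: "nat \<Rightarrow> (point set \<times> point set) set"
  where "unimodular_rel d = {(P, Q). \<exists>U t. U \<in> carrier_mat d d \<and> Determinant.det U \<in> {1, -1} \<and>
           t \<in> int_lattice d \<and> Q = affine_map d U t ` P}"

definition wide_polytopes :: "nat \<Rightarrow> nat \<Rightarrow> nat \<Rightarrow> point set set"
  where "wide_polytopes d n w = {P. lattice_polytope d P \<and> full_dimensional d P \<and>
           card (P \<inter> int_lattice d) = n \<and> lattice_width d P > real w}"

text \<open>
  The infimum is taken in \<^typ>\<open>enat\<close>, so that it is the least such number if there is one;
  the finiteness of the threshold is a theorem and not part of the definition.
\<close>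

definition finiteness_threshold_width :: "nat \<Rightarrow> enat"
  where "finiteness_threshold_width d =
    Inf {enat w | w. \<forall>n>0. finite (wide_polytopes d n w // unimodular_rel d)}"


subsection \<open>The three conditions\<close>

definition parity_complete :: "nat \<Rightarrow> point set \<Rightarrow> bool"
  where "parity_complete d X \<longleftrightarrow>
    (\<forall>z \<in> int_lattice d. \<exists>x \<in> X. \<exists>y \<in> int_lattice d. x - z = 2 *\<^sub>R y)"

definition has_interior_lattice_point :: "nat \<Rightarrow> point set \<Rightarrow> bool"
  where "has_interior_lattice_point d X \<longleftrightarrow>
    (Euclidean_space d interior_of (convex hull X)) \<inter> int_lattice d \<noteq> {}"

definition wider_than_threshold :: "nat \<Rightarrow> point set \<Rightarrow> bool"
  where "wider_than_threshold d X \<longleftrightarrow>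
    X \<noteq> {} \<and> ereal (lattice_width d X) > ereal_of_enat (finiteness_threshold_width d)"


subsection \<open>Algorithms\<close>

text \<open>
  Kleene's partial recursive functions. \<open>Prec\<close> recurses on and \<open>Mu\<close> searches for the first
  argument. There are no arities: a program that lacks an argument is undefined.
\<close>

datatype program =
    Zero
  | Succ
  | Proj nat
  | Comp program "program list"
  | Prec program program
  | Mu program

fun run :: "program \<Rightarrow> nat list \<Rightarrow> nat option"
  where
    "run Zero xs = Some 0"
  | "run Succ xs = (case xs of [] \<Rightarrow> None | x # _ \<Rightarrow> Some (Suc x))"
  | "run (Proj i) xs = (if i < length xs then Some (xs ! i) else None)"
  | "run (Comp f gs) xs = Option.bind (those (map (\<lambda>g. run g xs) gs)) (run f)"
  | "run (Prec f g) xs = (case xs of [] \<Rightarrow> None | n # ys \<Rightarrow>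
       rec_nat (run f ys) (\<lambda>m r. Option.bind r (\<lambda>y. run g (m # y # ys))) n)"
  | "run (Mu f) xs =
       (let halts_at = (\<lambda>n. run f (n # xs) = Some 0 \<and> (\<forall>m<n. \<exists>y>0. run f (m # xs) = Some y))
        in if \<exists>n. halts_at n then Some (THE n. halts_at n) else None)"

text \<open>
  A finite set of lattice points is given to a program as a list, in any order and possibly with
  repetitions, of integer coordinate vectors, encoded with the library's pairing function.
\<close>

definition point_of :: "int list \<Rightarrow> point"
  where "point_of p = (\<lambda>i. if i < length p then of_int (p ! i) else 0)"

definition lists_points :: "nat \<Rightarrow> int list list \<Rightarrow> point set \<Rightarrow> bool"
  where "lists_points d ps X \<longleftrightarrow> (\<forall>p \<in> set ps. length p = d) \<and> X = point_of ` set ps"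

definition encode_input :: "nat \<Rightarrow> int list list \<Rightarrow> nat"
  where "encode_input d ps =
    prod_encode (d, list_encode (map (\<lambda>p. list_encode (map int_encode p)) ps))"

end

theory Submission
  imports Defs
begin

text \<open>
  An \<^emph>\<open>observer\<close> of \<open>X\<close> is a lattice point \<open>z \<notin> X\<close> such that \<open>X \<union> {z}\<close> is lattice-convex.
  Every lattice point outside \<open>X\<close> forces an observer into the convex hull, so halfspaces containing
  \<open>X\<close> describe \<open>X\<close> as soon as they cut off all observers. Each of the three conditions makes \<open>X\<close>
  full-dimensional, so that equations are useless, and the set of observers finite:
  under (a) observers have the form \<open>2y - x\<close>; under (b) Dirichlet approximation finds a further
  lattice point in the cone from a distant observer over a cube in the interior; under (c) the polytopes
  \<open>conv (X \<union> {z})\<close> fall into finitely many classes.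

  Separating finite sets of lattice points is a matter of finitely many integral inequalities. By
  Fourier--Motzkin elimination either an integral normal vector separates them, or a positive integral
  combination of differences vanishes. Hence real and rational descriptions need equally many
  inequalities, and this number \<open>k\<close> has a finite certificate: integral inequalities together with a
  box whose boundary their polyhedron avoids by a safety margin, and vanishing combinations for all
  colourings, with \<open>k - 1\<close> colours, of the remaining points of the box. The algorithm searches for a
  certificate; the check is primitive recursive.
\<close>


subsection \<open>Computable functions on encodable types\<close>

text \<open>Only the finiteness of the set of observers is extracted from the three conditions: the
  program is told neither which condition holds nor the threshold width, and it never computes the
  observers. It therefore guesses the size \<open>M\<close> of the box together with the rest of the
  certificate. A box that misses observers does no harm, since every finite set of lattice points
  outside \<open>X\<close> yields a valid lower bound; finiteness of the observers guarantees that
  some box makes the bound sharp. As the same \<open>M\<close> also serves the upper bound, a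
  description has to be certifiable for all large \<open>M\<close>. The obstacle on that side is to
  recognise that inequalities have no further solution in the whole lattice. Inspecting the lattice
  points of a box is not enough, because a thin polyhedron may leave the box between lattice points.
  This is why the inequalities are tested on the boundary with weakened right-hand sides. The test
  succeeds eventually because recession directions do not depend on the right-hand sides, so that
  the weakened system still has only finitely many lattice solutions.\<close>

definition add_prog :: program where "add_prog = Prec (Proj 0) (Comp Succ [Proj 1])"
definition pred_prog :: program where "pred_prog = Prec Zero (Proj 0)"
text \<open>The subtrahend is the first argument, because \<open>Prec\<close> recurses on that
  one.\<close>

definition diff_prog :: program where "diff_prog = Prec (Proj 0) (Comp pred_prog [Proj 1])"
definition triangle_prog :: program
  where "triangle_prog = Prec Zero (Comp Succ [Comp add_prog [Proj 0, Proj 1]])"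
text \<open>The largest \<open>s\<close> with \<open>triangle s \<le> n\<close>, that is, the index
  of the diagonal of the pairing function on which \<open>n\<close> lies. Passing from
  \<open>n\<close> to \<open>n + 1\<close> raises it by
  \<open>1 - (triangle (s + 1) - (n + 1))\<close> in truncated subtraction, which is 1 exactly if
  the next diagonal has been reached.\<close>

definition root_prog :: program
  where "root_prog = Prec Zero (Comp add_prog [Proj 1,
    Comp diff_prog [Comp diff_prog [Comp Succ [Proj 0], Comp triangle_prog [Comp Succ [Proj 1]]],
      Comp Succ [Zero]]])"
definition pair_prog :: program
  where "pair_prog = Comp add_prog [Comp triangle_prog [add_prog], Proj 0]"
definition fst_prog :: program
  where "fst_prog = Comp diff_prog [Comp triangle_prog [root_prog], Proj 0]"
definition snd_prog :: program
  where "snd_prog = Comp diff_prog [fst_prog, root_prog]"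

lemma run_add [simp]: "run add_prog [m, n] = Some (m + n)"
  by (induction m) (simp_all add: add_prog_def)

lemma run_pred [simp]: "run pred_prog [n] = Some (n - 1)"
  by (induction n) (simp_all add: pred_prog_def)

lemma run_diff [simp]: "run diff_prog [m, n] = Some (n - m)"
  by (induction m) (simp_all add: diff_prog_def)

lemma run_triangle [simp]: "run triangle_prog [n] = Some (triangle n)"
  by (induction n) (simp_all add: triangle_prog_def)

lemma triangle_mono: "m \<le> n \<Longrightarrow> triangle m \<le> triangle n"
  by (induction rule: dec_induct) auto

lemma run_root: "\<exists>s. run root_prog [n] = Some s \<and> triangle s \<le> n \<and> n < triangle (Suc s)"
proof (induction n)
  case 0
  then show ?case by (simp add: root_prog_def)
next
  case (Suc n)
  then obtain s where s: "run root_prog [n] = Some s" "triangle s \<le> n" "n < triangle (Suc s)"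
    by blast
  have "run root_prog [Suc n] = Some (s + (1 - (triangle (Suc s) - Suc n)))"
    using s(1) by (simp add: root_prog_def)
  then show ?case using s(2,3)
    by (cases "triangle (Suc s) = Suc n") auto
qed

lemma run_root_prod_encode [simp]: "run root_prog [prod_encode (m, n)] = Some (m + n)"
proof -
  obtain s where s: "run root_prog [prod_encode (m, n)] = Some s"
    "triangle s \<le> prod_encode (m, n)" "prod_encode (m, n) < triangle (Suc s)"
    using run_root by blast
  have "s = m + n"
  proof (rule antisym; rule ccontr)
    assume "\<not> s \<le> m + n"
    then have "triangle (Suc (m + n)) \<le> triangle s" by (intro triangle_mono) auto
    then show False using s(2) by (simp add: prod_encode_def)
  next
    assume "\<not> m + n \<le> s"
    then have "triangle (Suc s) \<le> triangle (m + n)" by (intro triangle_mono) auto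
    then show False using s(3) by (simp add: prod_encode_def)
  qed
  then show ?thesis using s(1) by simp
qed

lemma run_pair [simp]: "run pair_prog [m, n] = Some (prod_encode (m, n))"
  by (simp add: pair_prog_def prod_encode_def)

lemma run_fst [simp]: "run fst_prog [prod_encode (m, n)] = Some m"
  by (simp add: fst_prog_def) (simp add: prod_encode_def)

lemma run_snd [simp]: "run snd_prog [prod_encode (m, n)] = Some n"
  by (simp add: snd_prog_def)

text \<open>A bijection rather than an injection: every number is the code of some value, so that a
  search through all numbers is a search through all values, and a program specified on codes is
  total.\<close>

class enc =
  fixes enc :: "'a \<Rightarrow> nat"
  assumes bij_enc: "bij enc"

lemma enc_eq_iff [simp]: "enc x = enc y \<longleftrightarrow> x = y"
  using bij_enc by (metis bij_pointE)

lemma enc_surj: "\<exists>x. enc x = n"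
  using bij_enc by (metis bij_pointE)

instantiation nat :: enc
begin
definition enc_nat :: "nat \<Rightarrow> nat" where "enc_nat n = n"
instance by standard (auto simp: enc_nat_def[abs_def] bij_def)
end

instantiation int :: enc
begin
definition enc_int :: "int \<Rightarrow> nat" where "enc_int = int_encode"
instance by standard (simp add: enc_int_def bij_int_encode)
end

instantiation prod :: (enc, enc) enc
begin
definition enc_prod :: "'a \<times> 'b \<Rightarrow> nat" where "enc_prod z = prod_encode (enc (fst z), enc (snd z))"
instance
proof
  have "(enc :: 'a \<times> 'b \<Rightarrow> nat) = prod_encode \<circ> map_prod enc enc"
    by (auto simp: enc_prod_def)
  moreover have "bij (map_prod (enc :: 'a \<Rightarrow> nat) (enc :: 'b \<Rightarrow> nat))"
    by (metis bij_enc bij_def prod.inj_map map_prod_surj)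
  ultimately show "bij (enc :: 'a \<times> 'b \<Rightarrow> nat)"
    by (metis bij_comp bij_prod_encode)
qed
end

instantiation list :: (enc) enc
begin
definition enc_list :: "'a list \<Rightarrow> nat" where "enc_list xs = list_encode (map enc xs)"
instance
proof
  have "(enc :: 'a list \<Rightarrow> nat) = list_encode \<circ> map enc"
    by (auto simp: enc_list_def)
  moreover have "bij (map (enc :: 'a \<Rightarrow> nat))"
  proof -
    obtain g :: "nat \<Rightarrow> 'a" where g: "\<forall>n. enc (g n) = n" using enc_surj by metis
    then have "\<forall>x. g (enc x) = x" using enc_eq_iff by blast
    then show ?thesis using g by (intro o_bij[of "map g"]) (auto simp: fun_eq_iff intro!: map_idI)
  qed
  ultimately show "bij (enc :: 'a list \<Rightarrow> nat)"
    by (metis bij_comp bij_list_encode)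
qed
end

lemma enc_Pair: "enc (x, y) = prod_encode (enc x, enc y)"
  by (simp add: enc_prod_def)

lemma enc_Nil: "enc [] = 0"
  by (simp add: enc_list_def)

lemma enc_Cons: "enc (x # xs) = Suc (enc (x, xs))"
  by (simp add: enc_list_def enc_Pair)

lemma encode_input_eq_enc: "encode_input d ps = enc (d, ps)"
  unfolding encode_input_def enc_Pair enc_list_def enc_int_def enc_nat_def by (simp add: enc_list_def[abs_def] enc_int_def)

text \<open>Supplies a number of iterations that is certainly enough to traverse a list of which
  only the code is at hand.\<close>

lemma length_le_enc: "length xs \<le> enc xs"
proof (induction xs)
  case (Cons x xs)
  then show ?case
    using le_prod_encode_2[of "enc xs" "enc x"] by (simp add: enc_Cons enc_Pair)
qed simp

text \<open>Several arguments are passed as one nested pair. Hence all functions are unary, and a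
  parameter of a higher-order operation is threaded through as the first component of such a
  pair.\<close>

definition computable :: "('a::enc \<Rightarrow> 'b::enc) \<Rightarrow> bool"
  where "computable f \<longleftrightarrow> (\<exists>p. \<forall>x. run p [enc x] = Some (enc (f x)))"

definition decidable :: "('a::enc \<Rightarrow> bool) \<Rightarrow> bool"
  where "decidable P \<longleftrightarrow> computable (\<lambda>x. of_bool (P x) :: nat)"

named_theorems computable_intros

section \<open>Closure properties of computable functions and decidable predicates\<close>

lemma computable_id [computable_intros]: "computable (\<lambda>x. x)"
  unfolding computable_def by (rule exI[of _ "Proj 0"]) simp

lemma computable_const [computable_intros]: "computable (\<lambda>x. c)"
proof -
  have "\<exists>p. \<forall>x. run p [x] = Some n" for n
  proof (induction n)
    case 0
    show ?case by (rule exI[of _ Zero]) simp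
  next
    case (Suc n)
    then obtain p where "\<forall>x. run p [x] = Some n" by blast
    then show ?case by (intro exI[of _ "Comp Succ [p]"]) simp
  qed
  then show ?thesis unfolding computable_def by blast
qed

lemma computable_compose:
  assumes "computable g" "computable f"
  shows "computable (\<lambda>x. g (f x))"
proof -
  obtain p q where "\<forall>x. run p [enc x] = Some (enc (g x))" "\<forall>x. run q [enc x] = Some (enc (f x))"
    using assms unfolding computable_def by blast
  then show ?thesis unfolding computable_def by (intro exI[of _ "Comp p [q]"]) simp
qed

lemma computable_binary:
  assumes "\<And>a b. run p [enc a, enc b] = Some (enc (h a b))" "computable f" "computable g"
  shows "computable (\<lambda>x. h (f x) (g x))"
proof -
  obtain q r where "\<forall>x. run q [enc x] = Some (enc (f x))" "\<forall>x. run r [enc x] = Some (enc (g x))"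
    using assms unfolding computable_def by blast
  then show ?thesis unfolding computable_def using assms(1) by (intro exI[of _ "Comp p [q, r]"]) simp
qed

lemma computable_Pair [computable_intros]: "computable f \<Longrightarrow> computable g \<Longrightarrow> computable (\<lambda>x. (f x, g x))"
  by (rule computable_binary[of pair_prog]) (simp_all add: enc_Pair)

lemma computable_fst [computable_intros]: "computable f \<Longrightarrow> computable (\<lambda>x. fst (f x))"
  by (rule computable_compose[of fst]) (auto simp: computable_def enc_prod_def intro!: exI[of _ fst_prog])

lemma computable_snd [computable_intros]: "computable f \<Longrightarrow> computable (\<lambda>x. snd (f x))"
  by (rule computable_compose[of snd]) (auto simp: computable_def enc_prod_def intro!: exI[of _ snd_prog])

lemma computable_enc_iff: "computable (\<lambda>x. enc (f x)) \<longleftrightarrow> computable f"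
  by (simp add: computable_def enc_nat_def)

lemma computable_rec_nat [computable_intros]:
  fixes a :: "'a::enc \<Rightarrow> 'b::enc"
  assumes "computable a" "computable (\<lambda>z. g (fst z) (fst (snd z)) (snd (snd z)))" "computable n"
  shows "computable (\<lambda>x. rec_nat (a x) (\<lambda>m r. g x m r) (n x))"
proof -
  obtain p q s where p: "\<forall>x. run p [enc x] = Some (enc (a x))"
    and q: "\<forall>z. run q [enc z] = Some (enc (g (fst z) (fst (snd z)) (snd (snd z))))"
    and s: "\<forall>x. run s [enc x] = Some (enc (n x))"
    using assms unfolding computable_def by blast
  have q': "run q [prod_encode (enc x, prod_encode (m, enc r))] = Some (enc (g x m r))" for x m r
    using q[rule_format, of "(x, m, r)"] by (simp add: enc_Pair enc_nat_def)
  \<comment> \<open>\<open>Prec\<close> supplies the counter, the previous value and the parameter,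
    in this order; they are repacked into the code of \<open>(x, m, r)\<close>.\<close>
  define t where "t = Prec p (Comp q [Comp pair_prog [Proj 2, Comp pair_prog [Proj 0, Proj 1]]])"
  have "run t [m, enc x] = Some (enc (rec_nat (a x) (\<lambda>m r. g x m r) m))" for m x
    by (induction m) (simp_all add: t_def p q')
  then show ?thesis unfolding computable_def using s
    by (intro exI[of _ "Comp t [s, Proj 0]"]) (simp add: enc_nat_def)
qed

lemma computable_Suc [computable_intros]: "computable f \<Longrightarrow> computable (\<lambda>x. Suc (f x))"
  by (rule computable_compose[of Suc]) (auto simp: computable_def enc_nat_def intro!: exI[of _ Succ])

lemma computable_add_nat [computable_intros]: "computable f \<Longrightarrow> computable g \<Longrightarrow> computable (\<lambda>x. f x + g x :: nat)"
  by (rule computable_binary[of add_prog]) (simp_all add: enc_nat_def)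

lemma computable_diff_nat [computable_intros]: "computable f \<Longrightarrow> computable g \<Longrightarrow> computable (\<lambda>x. f x - g x :: nat)"
  by (rule computable_binary[of diff_prog "\<lambda>a b. b - a", of g f]) (simp_all add: enc_nat_def)

lemma computable_mult_nat [computable_intros]:
  assumes "computable f" "computable g"
  shows "computable (\<lambda>x. f x * g x :: nat)"
proof -
  have "m * n = rec_nat 0 (\<lambda>_ r. n + r) m" for m n :: nat
    by (induction m) auto
  moreover have "computable (\<lambda>x. rec_nat 0 (\<lambda>_ r. g x + r) (f x))"
    by (intro computable_intros assms computable_compose[OF assms(2)])
  ultimately show ?thesis by presburger
qed

lemma decidableI: "computable f \<Longrightarrow> (\<And>x. P x \<longleftrightarrow> f x = (0::nat)) \<Longrightarrow> decidable P"
proof -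
  assume "computable f" and P: "\<And>x. P x \<longleftrightarrow> f x = (0::nat)"
  then have "computable (\<lambda>x. 1 - f x)" by (intro computable_intros)
  moreover have "(\<lambda>x. 1 - f x) = (\<lambda>x. of_bool (P x))" using P by (auto simp: of_bool_def)
  ultimately show ?thesis unfolding decidable_def by simp
qed

lemma decidable_compose: "decidable P \<Longrightarrow> computable f \<Longrightarrow> decidable (\<lambda>x. P (f x))"
  unfolding decidable_def by (rule computable_compose)

lemma computable_of_bool: "decidable P \<Longrightarrow> computable (\<lambda>x. of_bool (P x) :: nat)"
  by (simp add: decidable_def)

lemma computable_If [computable_intros]:
  assumes "decidable P" "computable f" "computable g"
  shows "computable (\<lambda>x. if P x then f x else g x)"
proof -
  have "computable (\<lambda>x. rec_nat (g x) (\<lambda>_ _. f x) (of_bool (P x)))"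
    by (intro computable_intros assms computable_compose[OF assms(2)] computable_of_bool)
  moreover have "(\<lambda>x. rec_nat (g x) (\<lambda>_ _. f x) (of_bool (P x))) = (\<lambda>x. if P x then f x else g x)"
    by auto
  ultimately show ?thesis by simp
qed

lemma decidable_not [computable_intros]: "decidable P \<Longrightarrow> decidable (\<lambda>x. \<not> P x)"
  by (rule decidableI[OF computable_of_bool]) auto

lemma decidable_conj [computable_intros]:
  assumes "decidable P" "decidable Q"
  shows "decidable (\<lambda>x. P x \<and> Q x)"
proof (rule decidableI)
  show "computable (\<lambda>x. 1 - of_bool (P x) * of_bool (Q x) :: nat)" by (intro computable_intros computable_of_bool assms)
qed auto

lemma decidable_disj [computable_intros]:
  assumes "decidable P" "decidable Q"
  shows "decidable (\<lambda>x. P x \<or> Q x)"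
  using decidable_not[OF decidable_conj[OF assms[THEN decidable_not]]] by simp

lemma decidable_le_nat [computable_intros]: "computable f \<Longrightarrow> computable g \<Longrightarrow> decidable (\<lambda>x. f x \<le> (g x :: nat))"
  by (rule decidableI[of "\<lambda>x. f x - g x"]) (auto intro: computable_intros)

lemma decidable_eq [computable_intros]:
  assumes "computable f" "computable g"
  shows "decidable (\<lambda>x. f x = g x)"
proof -
  have "decidable (\<lambda>x. enc (f x) \<le> enc (g x) \<and> enc (g x) \<le> enc (f x))"
    using assms by (intro computable_intros) (simp_all only: computable_enc_iff)
  then show ?thesis by (simp add: order_eq_iff[symmetric])
qed

section \<open>List operations\<close>

lemma computable_Cons [computable_intros]:
  assumes "computable f" "computable g"
  shows "computable (\<lambda>x. f x # g x)"
proof -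
  have "computable (\<lambda>x. Suc (enc (f x, g x)))"
    using assms by (intro computable_intros) (simp add: computable_enc_iff computable_intros)
  then show ?thesis unfolding enc_Cons[symmetric] computable_enc_iff .
qed

text \<open>The code of a nonempty list is the successor of the code of the pair of head and tail. A
  primitive recursion that ignores its recursive value therefore performs the case
  distinction.\<close>

lemma computable_case_list [computable_intros]:
  fixes l :: "'a::enc \<Rightarrow> 'b::enc list" and a :: "'a \<Rightarrow> 'c::enc"
  assumes "computable a" "computable (\<lambda>z. c (fst z) (fst (snd z)) (snd (snd z)))" "computable l"
  shows "computable (\<lambda>x. case l x of [] \<Rightarrow> a x | y # ys \<Rightarrow> c x y ys)"
proof -
  obtain p q s where p: "\<forall>x. run p [enc x] = Some (enc (a x))"
    and q: "\<forall>z. run q [enc z] = Some (enc (c (fst z) (fst (snd z)) (snd (snd z))))"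
    and s: "\<forall>x. run s [enc x] = Some (enc (l x))"
    using assms unfolding computable_def by blast
  have q': "run q [prod_encode (enc x, enc (y, ys))] = Some (enc (c x y ys))" for x y ys
    using q[rule_format, of "(x, y, ys)"] by (simp add: enc_Pair)
  define t where "t = Prec p (Comp q [Comp pair_prog [Proj 2, Proj 0]])"
  \<comment> \<open>Although the recursive value is discarded, \<open>Prec\<close> is undefined
    unless all earlier values exist. Each earlier number is the code of a pair, so they do.\<close>
  have t: "\<exists>u. run t [m, enc x] = Some u" for m and x :: 'a
  proof (induction m)
    case (Suc m)
    obtain y :: 'b and ys :: "'b list" where "enc (y, ys) = m" by (metis enc_surj surj_pair)
    then show ?case using Suc q'[of x y ys] by (auto simp: t_def)
  qed (simp add: t_def p)
  have "run t [enc ys, enc x] = Some (enc (case ys of [] \<Rightarrow> a x | y # ys \<Rightarrow> c x y ys))"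
    for ys :: "'b list" and x :: 'a
  proof (cases ys)
    case (Cons z zs)
    then show ?thesis using t[of "enc (z, zs)" x] by (auto simp: t_def enc_Cons q')
  qed (simp add: t_def enc_Nil p)
  then show ?thesis unfolding computable_def using s
    by (intro exI[of _ "Comp t [s, Proj 0]"]) simp
qed

text \<open>The state consists of the remaining list and the accumulator. It is advanced as often as
  the code of the list says, which is at least its length; once the list is exhausted the state no
  longer changes.\<close>

lemma computable_fold [computable_intros]:
  fixes l :: "'a::enc \<Rightarrow> 'b::enc list" and a :: "'a \<Rightarrow> 'c::enc"
  assumes "computable (\<lambda>z. c (fst z) (fst (snd z)) (snd (snd z)))" "computable l" "computable a"
  shows "computable (\<lambda>x. fold (c x) (l x) (a x))"
proof -
  define step where "step x s = (case fst s of [] \<Rightarrow> s | y # ys \<Rightarrow> (ys, c x y (snd s)))" for x s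
  have "rec_nat (ys, b) (\<lambda>_. step x) n = (drop n ys, fold (c x) (take n ys) b)" for x ys b n
  proof (induction n)
    case (Suc n)
    show ?case
    proof (cases "n < length ys")
      case True
      then show ?thesis using Suc
        by (simp add: step_def Cons_nth_drop_Suc[symmetric] take_Suc_conv_app_nth)
    qed (simp add: Suc, simp add: step_def)
  qed simp
  then have "fold (c x) (l x) (a x) = snd (rec_nat (l x, a x) (\<lambda>_. step x) (enc (l x)))" for x
    using length_le_enc[of "l x"] by simp
  moreover have "computable (\<lambda>x. snd (rec_nat (l x, a x) (\<lambda>_ s. step x s) (enc (l x))))"
    unfolding step_def using assms(2,3)
    by (intro computable_intros computable_compose[OF assms(1), of "\<lambda>z. (f z, g z, h z)" for f g h, simplified])
      (simp_all only: computable_enc_iff)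
  ultimately show ?thesis by simp
qed


lemma computable_rev [computable_intros]:
  assumes "computable l"
  shows "computable (\<lambda>x. rev (l x))"
proof -
  have "rev ys = fold Cons ys []" for ys :: "'b list" by (simp add: fold_Cons_rev)
  then show ?thesis by (simp add: computable_intros assms)
qed

lemma computable_foldr [computable_intros]:
  assumes "computable (\<lambda>z. c (fst z) (fst (snd z)) (snd (snd z)))" "computable l" "computable a"
  shows "computable (\<lambda>x. foldr (c x) (l x) (a x))"
  unfolding foldr_conv_fold by (intro computable_intros assms)

lemma computable_append [computable_intros]:
  assumes "computable f" "computable g"
  shows "computable (\<lambda>x. f x @ g x)"
proof -
  have "ys @ zs = foldr Cons ys zs" for ys zs :: "'b list" by (induction ys) auto
  moreover have "computable (\<lambda>x. foldr Cons (f x) (g x))" by (intro computable_intros assms)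
  ultimately show ?thesis by simp
qed

lemma computable_concat [computable_intros]: "computable f \<Longrightarrow> computable (\<lambda>x. concat (f x))"
  unfolding concat_conv_foldr by (intro computable_intros)

lemma computable_map [computable_intros]:
  assumes "computable (\<lambda>z. g (fst z) (snd z))" "computable l"
  shows "computable (\<lambda>x. map (g x) (l x))"
proof -
  have "map h ys = foldr (\<lambda>y r. h y # r) ys []" for h :: "'b \<Rightarrow> 'c" and ys by (induction ys) auto
  moreover have "computable (\<lambda>x. foldr (\<lambda>y r. g x y # r) (l x) [])"
    by (intro computable_intros assms(2) computable_compose[OF assms(1), of "\<lambda>z. (f z, h z)" for f h, simplified])
  ultimately show ?thesis by simp
qed

lemma computable_filter [computable_intros]:
  assumes "decidable (\<lambda>z. P (fst z) (snd z))" "computable l"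
  shows "computable (\<lambda>x. filter (P x) (l x))"
proof -
  have "filter Q ys = foldr (\<lambda>y r. if Q y then y # r else r) ys []" for Q :: "'b \<Rightarrow> bool" and ys
    by (induction ys) auto
  moreover have "computable (\<lambda>x. foldr (\<lambda>y r. if P x y then y # r else r) (l x) [])"
    by (intro computable_intros assms(2) decidable_compose[OF assms(1), of "\<lambda>z. (f z, h z)" for f h, simplified])
  ultimately show ?thesis by simp
qed

lemma computable_length [computable_intros]:
  assumes "computable l"
  shows "computable (\<lambda>x. length (l x))"
proof -
  have "length ys = foldr (\<lambda>_. Suc) ys 0" for ys :: "'b list" by (induction ys) auto
  then show ?thesis by (simp add: computable_intros assms)
qed

lemma decidable_Ball_set [computable_intros]:
  assumes "computable l" "decidable (\<lambda>z. P (fst z) (snd z))"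
  shows "decidable (\<lambda>x. \<forall>y\<in>set (l x). P x y)"
proof -
  have "decidable (\<lambda>x. filter (\<lambda>y. \<not> P x y) (l x) = [])" by (intro computable_intros assms)
  then show ?thesis by (simp add: filter_empty_conv)
qed

lemma decidable_Bex_set [computable_intros]:
  assumes "computable l" "decidable (\<lambda>z. P (fst z) (snd z))"
  shows "decidable (\<lambda>x. \<exists>y\<in>set (l x). P x y)"
  using decidable_not[OF decidable_Ball_set[OF assms(1) decidable_not[OF assms(2)]]] by simp

lemma decidable_mem_set [computable_intros]:
  assumes "computable f" "computable l"
  shows "decidable (\<lambda>x. f x \<in> set (l x))"
proof -
  have "decidable (\<lambda>x. \<exists>y\<in>set (l x). f x = y)"
    by (intro computable_intros assms(2) computable_compose[OF assms(1)])
  then show ?thesis by simp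
qed

lemma computable_upt [computable_intros]:
  assumes "computable n"
  shows "computable (\<lambda>x. [0..<n x])"
proof -
  have "[0..<m] = rec_nat [] (\<lambda>k r. r @ [k]) m" for m by (induction m) auto
  then show ?thesis by (simp add: computable_intros assms)
qed

lemma computable_replicate [computable_intros]:
  assumes "computable n" "computable f"
  shows "computable (\<lambda>x. replicate (n x) (f x))"
  unfolding map_replicate_const[symmetric]
proof -
  have "replicate m y = map (\<lambda>_. y) [0..<m]" for m and y :: 'b by (simp add: map_replicate_const)
  moreover have "computable (\<lambda>x. map (\<lambda>_. f x) [0..<n x])"
    by (intro computable_intros assms(1) computable_compose[OF assms(2)])
  ultimately show "computable (\<lambda>x. replicate (n x) (f x))" by simp
qed

lemma computable_product_lists [computable_intros]:
  assumes "computable l"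
  shows "computable (\<lambda>x. product_lists (l x))"
proof -
  have "product_lists xss = foldr (\<lambda>xs r. concat (map (\<lambda>x. map (\<lambda>p. x # p) r) xs)) xss [[]]"
    for xss :: "'b list list" by (induction xss) auto
  then show ?thesis by (simp add: computable_intros assms)
qed

section \<open>Integer arithmetic on codes\<close>

lemma computable_mod2:
  assumes "computable f"
  shows "computable (\<lambda>x. f x mod 2 :: nat)"
proof -
  have "n mod 2 = rec_nat 0 (\<lambda>_ r. 1 - r) n" for n :: nat by (induction n) (auto, presburger+)
  then show ?thesis using assms by (simp add: computable_intros del: One_nat_def)
qed

lemma computable_div2:
  assumes "computable f"
  shows "computable (\<lambda>x. f x div 2 :: nat)"
proof -
  have "n div 2 = rec_nat 0 (\<lambda>k r. r + k mod 2) n" for n :: nat by (induction n) (auto, presburger+)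
  moreover have "computable (\<lambda>x. rec_nat 0 (\<lambda>k r. r + k mod 2) (f x))" by (intro computable_intros computable_mod2 assms)
  ultimately show ?thesis by simp
qed

text \<open>\<open>int_encode\<close> maps \<open>i \<ge> 0\<close> to \<open>2 * i\<close> and
  \<open>i < 0\<close> to \<open>- 2 * i - 1\<close>, so parity and half of the code give the sign
  and the absolute value.\<close>

lemma computable_nat [computable_intros]:
  assumes "computable f"
  shows "computable (\<lambda>x. nat (f x))" "computable (\<lambda>x. nat (- f x))"
proof -
  have e: "computable (\<lambda>x. enc (f x))" using assms by (simp add: computable_enc_iff)
  have "nat i = (if enc i mod 2 = 0 then enc i div 2 else 0)" for i
    by (auto simp: enc_int_def int_encode_def sum_encode_def)
  moreover have "computable (\<lambda>x. if enc (f x) mod 2 = 0 then enc (f x) div 2 else 0)"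
    by (intro computable_intros computable_div2 computable_mod2 e)
  ultimately show "computable (\<lambda>x. nat (f x))" by simp
  have "nat (- i) = (if enc i mod 2 = 0 then 0 else Suc (enc i div 2))" for i
    by (auto simp: enc_int_def int_encode_def sum_encode_def)
  moreover have "computable (\<lambda>x. if enc (f x) mod 2 = 0 then 0 else Suc (enc (f x) div 2))"
    by (intro computable_intros computable_div2 computable_mod2 e)
  ultimately show "computable (\<lambda>x. nat (- f x))" by simp
qed

text \<open>The way back from natural numbers to integers: sums, differences and products of
  integers are computed on positive and negative parts and recombined here.\<close>

lemma computable_int_diff:
  assumes "computable f" "computable g"
  shows "computable (\<lambda>x. int (f x) - int (g x))"
proof -
  have "enc (int m - int n) = (if n \<le> m then 2 * (m - n) else 2 * (n - m) - 1)" for m n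
    by (auto simp: enc_int_def int_encode_def sum_encode_def)
  moreover have "computable (\<lambda>x. if g x \<le> f x then 2 * (f x - g x) else 2 * (g x - f x) - 1)"
    by (intro computable_intros assms)
  ultimately show ?thesis by (subst computable_enc_iff[symmetric]) simp
qed

lemma computable_int [computable_intros]: "computable f \<Longrightarrow> computable (\<lambda>x. int (f x))"
  using computable_int_diff[OF _ computable_const[of 0], of f] by simp

lemma computable_arith_int [computable_intros]:
  fixes f g :: "'a::enc \<Rightarrow> int"
  assumes "computable f" "computable g"
  shows "computable (\<lambda>x. f x + g x)" "computable (\<lambda>x. f x - g x)" "computable (\<lambda>x. f x * g x)"
proof -
  have "f x + g x = int (nat (f x) + nat (g x)) - int (nat (- f x) + nat (- g x))"
    "f x - g x = int (nat (f x) + nat (- g x)) - int (nat (- f x) + nat (g x))"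
    "f x * g x = int (nat (f x) * nat (g x) + nat (- f x) * nat (- g x))
      - int (nat (f x) * nat (- g x) + nat (- f x) * nat (g x))" for x
    by (cases "f x \<ge> 0"; cases "g x \<ge> 0"; simp)+
  then show "computable (\<lambda>x. f x + g x)" "computable (\<lambda>x. f x - g x)" "computable (\<lambda>x. f x * g x)"
    by (simp_all only:) (intro computable_intros computable_int_diff assms)+
qed

lemma computable_abs_int [computable_intros]:
  assumes "computable f"
  shows "computable (\<lambda>x. \<bar>f x :: int\<bar>)"
proof -
  have "\<bar>i\<bar> = int (nat i + nat (- i))" for i by auto
  moreover have "computable (\<lambda>x. int (nat (f x) + nat (- f x)))" by (intro computable_intros assms)
  ultimately show ?thesis by presburger
qed

lemma decidable_le_int [computable_intros]:
  assumes "computable f" "computable g"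
  shows "decidable (\<lambda>x. f x \<le> (g x :: int))"
proof -
  have "decidable (\<lambda>x. nat (f x - g x) = 0)" by (intro computable_intros assms)
  then show ?thesis by simp
qed

lemma decidable_less [computable_intros]:
  "computable f \<Longrightarrow> computable g \<Longrightarrow> decidable (\<lambda>x. f x < (g x :: nat))"
  "computable h \<Longrightarrow> computable i \<Longrightarrow> decidable (\<lambda>x. h x < (i x :: int))"
  unfolding not_le[symmetric] by (intro computable_intros; assumption)+

lemma computable_sum_list_int [computable_intros]:
  assumes "computable l"
  shows "computable (\<lambda>x. sum_list (l x) :: int)"
  unfolding sum_list.eq_foldr by (intro computable_intros assms)

text \<open>\<open>Mu\<close> looks for the value 0, so the truth value of the check is inverted.
  The check is total, hence the search stops at the least code of a witness. Which witness is found
  is left open; its output is what matters.\<close>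

lemma run_search:
  fixes Q :: "'a::enc \<Rightarrow> 'b::enc \<Rightarrow> bool" and out :: "'b \<Rightarrow> nat"
  assumes "decidable (\<lambda>z. Q (fst z) (snd z))" "computable out"
  shows "\<exists>alg. \<forall>x. (\<exists>c. Q x c) \<longrightarrow> (\<exists>c. Q x c \<and> run alg [enc x] = Some (out c))"
proof -
  have "computable (\<lambda>z. 1 - of_bool (Q (fst z) (snd z)) :: nat)" by (intro computable_intros computable_of_bool assms)
  then obtain p where p: "\<And>x c. run p [prod_encode (enc x, enc c)] = Some (1 - of_bool (Q x c))"
    unfolding computable_def by (metis enc_Pair enc_nat_def fst_conv snd_conv)
  define t where "t = Comp p [Comp pair_prog [Proj 1, Proj 0]]"
  have t: "run t [enc c, enc x] = Some (1 - of_bool (Q x c))" for x c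
    by (simp add: t_def p)
  obtain q where q: "\<And>c. run q [enc c] = Some (out c)"
    using assms(2) unfolding computable_def enc_nat_def by blast
  have "\<exists>c. Q x c \<and> run (Comp q [Mu t]) [enc x] = Some (out c)" if "\<exists>c. Q x c" for x
  proof -
    define H where "H = (\<lambda>n. run t (n # [enc x]) = Some 0 \<and> (\<forall>m<n. \<exists>y>0. run t (m # [enc x]) = Some y))"
    define n0 where "n0 = (LEAST n. run t [n, enc x] = Some 0)"
    have "\<exists>n. run t [n, enc x] = Some 0" using that t[where ?x = x] by (metis diff_self_eq_0 of_bool_eq(2))
    then have n0: "run t [n0, enc x] = Some 0" unfolding n0_def by (rule LeastI_ex)
    have less: "run t [m, enc x] \<noteq> Some 0" if "m < n0" for m
      using that not_less_Least unfolding n0_def by blast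
    have tot: "\<exists>y. run t [m, enc x] = Some y" for m
      using t enc_surj by metis
    have "H n0" unfolding H_def using n0 less tot by (metis gr0I)
    moreover have "n = n0" if "H n" for n
      using that \<open>H n0\<close> unfolding H_def by (metis less_numeral_extra(3) linorder_neqE_nat option.inject)
    ultimately have "run (Mu t) [enc x] = Some n0"
      unfolding run.simps Let_def H_def[symmetric] by (metis the_equality)
    moreover obtain c :: 'b where c: "enc c = n0" using enc_surj by blast
    moreover have "Q x c" using n0 t[of c x] c by (cases "Q x c") auto
    ultimately show ?thesis using q by (intro exI[of _ c]) auto
  qed
  then show ?thesis by blast
qed

subsection \<open>Convex hulls and observers\<close>

lemma in_topspace_iff: "x \<in> topspace (Euclidean_space d) \<longleftrightarrow> (\<forall>i\<ge>d. x i = 0)"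
  by (simp add: topspace_Euclidean_space)

lemma int_lattice_iff: "x \<in> int_lattice d \<longleftrightarrow> (\<forall>i\<ge>d. x i = 0) \<and> (\<forall>i. x i \<in> \<int>)"
  by (simp add: int_lattice_def in_topspace_iff)

lemma dotp_add: "dotp d u (x + y) = dotp d u x + dotp d u y"
  by (simp add: dotp_def distrib_left sum.distrib)

lemma dotp_diff: "dotp d u (x - y) = dotp d u x - dotp d u y"
  by (simp add: dotp_def right_diff_distrib sum_subtractf)

lemma dotp_scaleR: "dotp d u (c *\<^sub>R x) = c * dotp d u x"
  by (simp add: dotp_def scaleR_fun_def sum_distrib_left mult_ac)

lemma dotp_zero [simp]: "dotp d u 0 = 0"
  by (simp add: dotp_def)

lemma linear_dotp: "linear (dotp d u)"
  by (rule linearI) (simp_all add: dotp_add dotp_scaleR)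

lemma convex_dotp_le: "convex {x. dotp d u x \<le> b}"
proof -
  have "{x. dotp d u x \<le> b} = dotp d u -` {..b}" by auto
  then show ?thesis by (metis convex_linear_vimage linear_dotp convex_real_interval(2))
qed

lemma convex_dotp_eq: "convex {x. dotp d u x = b}"
proof -
  have "{x. dotp d u x = b} = dotp d u -` {b}" by auto
  then show ?thesis by (metis convex_linear_vimage linear_dotp convex_singleton)
qed

lemma convex_coord_le: "convex {x :: point. x i \<le> b}" "convex {x :: point. b \<le> x i}"
  "convex {x :: point. x i = b}"
proof -
  have *: "linear (\<lambda>x :: point. x i)" by (rule linearI) (simp_all add: scaleR_fun_def)
  have "{x :: point. x i \<le> b} = (\<lambda>x. x i) -` {..b}" "{x :: point. b \<le> x i} = (\<lambda>x. x i) -` {b..}"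
    "{x :: point. x i = b} = (\<lambda>x. x i) -` {b}"
    by auto
  then show "convex {x :: point. x i \<le> b}" "convex {x :: point. b \<le> x i}" "convex {x :: point. x i = b}"
    by (metis convex_linear_vimage[OF *] convex_real_interval(1,2) convex_singleton)+
qed

lemma hull_subset_topspace:
  assumes "X \<subseteq> topspace (Euclidean_space d)"
  shows "convex hull X \<subseteq> topspace (Euclidean_space d)"
proof -
  have "topspace (Euclidean_space d) = (\<Inter>i\<in>{d..}. {x. x i = 0})"
    by (auto simp: in_topspace_iff)
  then have "convex (topspace (Euclidean_space d))"
    by (simp add: convex_INT convex_coord_le)
  then show ?thesis using assms by (simp add: hull_minimal)
qed

lemma finite_lattice_box: "finite {x \<in> int_lattice d. \<forall>i<d. \<bar>x i\<bar> \<le> B}"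
proof -
  define F where "F = {x :: point. \<forall>i. (i \<in> {..<d} \<longrightarrow> x i \<in> real_of_int ` {- \<lceil>B\<rceil> .. \<lceil>B\<rceil>})
    \<and> (i \<notin> {..<d} \<longrightarrow> x i = 0)}"
  have "finite F" unfolding F_def by (intro finite_set_of_finite_funs) auto
  moreover have "{x \<in> int_lattice d. \<forall>i<d. \<bar>x i\<bar> \<le> B} \<subseteq> F"
  proof
    fix x assume x: "x \<in> {x \<in> int_lattice d. \<forall>i<d. \<bar>x i\<bar> \<le> B}"
    have "x i \<in> real_of_int ` {- \<lceil>B\<rceil> .. \<lceil>B\<rceil>}" if "i < d" for i
    proof -
      have "x i \<in> \<int>" "\<bar>x i\<bar> \<le> B" using x that by (auto simp: int_lattice_iff)
      then obtain k where "x i = of_int k" "\<bar>real_of_int k\<bar> \<le> B" by (auto elim: Ints_cases)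
      then have "k \<in> {- \<lceil>B\<rceil> .. \<lceil>B\<rceil>}" by (auto; linarith)
      then show ?thesis using \<open>x i = of_int k\<close> by blast
    qed
    moreover have "x i = 0" if "\<not> i < d" for i using x that by (auto simp: int_lattice_iff)
    ultimately show "x \<in> F" by (auto simp: F_def)
  qed
  ultimately show ?thesis by (rule rev_finite_subset)
qed

lemma finite_coord_bound:
  fixes X :: "point set"
  assumes "finite X"
  obtains B where "B \<ge> 0" "\<And>x i. x \<in> X \<Longrightarrow> i < d \<Longrightarrow> \<bar>x i\<bar> \<le> B"
proof
  let ?B = "\<Sum>x\<in>X. \<Sum>i<d. \<bar>x i\<bar>"
  show "?B \<ge> 0" by (intro sum_nonneg) auto
  show "\<bar>x i\<bar> \<le> ?B" if "x \<in> X" "i < d" for x i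
  proof -
    have "\<bar>x i\<bar> \<le> (\<Sum>i<d. \<bar>x i\<bar>)" using that by (intro member_le_sum) auto
    also have "\<dots> \<le> ?B" using that assms by (intro member_le_sum[of x X "\<lambda>x. \<Sum>i<d. \<bar>x i\<bar>"]) (auto intro: sum_nonneg)
    finally show ?thesis .
  qed
qed

lemma finite_hull_lattice:
  assumes "finite X"
  shows "finite (convex hull X \<inter> int_lattice d)"
proof -
  obtain B where B: "\<And>x i. x \<in> X \<Longrightarrow> i < d \<Longrightarrow> \<bar>x i\<bar> \<le> B" using finite_coord_bound[OF assms] by metis
  have "\<bar>x i\<bar> \<le> B" if "x \<in> convex hull X" "i < d" for x i
  proof -
    have "convex hull X \<subseteq> {x. x i \<le> B} \<inter> {x. - B \<le> x i}"
      using B[OF _ that(2)] by (intro hull_minimal convex_Int convex_coord_le) (fastforce simp: abs_le_iff)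
    then show ?thesis using that(1) by (auto simp: abs_le_iff)
  qed
  then show ?thesis by (intro finite_subset[OF _ finite_lattice_box[of d B]]) auto
qed

section \<open>Observers and their existence in hulls\<close>

definition observers :: "nat \<Rightarrow> point set \<Rightarrow> point set"
  where "observers d X = {z \<in> int_lattice d - X. convex hull (insert z X) \<inter> int_lattice d = insert z X}"

text \<open>Write \<open>x\<close> as a combination of \<open>y\<close> and a hull point with weight
  \<open>u\<close> on \<open>y\<close>, and \<open>y\<close> likewise with weight \<open>v\<close>
  on \<open>x\<close>. Substituting one into the other and dividing by \<open>1 - u * v\<close>
  expresses \<open>x\<close> by hull points alone, unless both weights are 1.\<close>

lemma hull_insert_antisym:
  fixes x y :: "'a::real_vector"
  assumes "x \<in> convex hull (insert y X)" "y \<in> convex hull (insert x X)" "X \<noteq> {}"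
  shows "x = y \<or> x \<in> convex hull X"
proof -
  have *: "\<exists>u c. 0 \<le> u \<and> u \<le> 1 \<and> c \<in> convex hull X \<and> p = u *\<^sub>R q + (1 - u) *\<^sub>R c"
    if pq: "p \<in> convex hull (insert q X)" for p q
  proof -
    obtain u w c where "0 \<le> u" "0 \<le> w" "u + w = 1" "c \<in> convex hull X" "p = u *\<^sub>R q + w *\<^sub>R c"
      using pq unfolding convex_hull_insert[OF assms(3)] by blast
    moreover from this have "w = 1 - u" by simp
    ultimately show ?thesis by (intro exI[of _ u] exI[of _ c]) simp
  qed
  obtain u c where u: "0 \<le> u" "u \<le> 1" "c \<in> convex hull X" "x = u *\<^sub>R y + (1 - u) *\<^sub>R c"
    using *[OF assms(1)] by blast
  obtain v e where v: "0 \<le> v" "v \<le> 1" "e \<in> convex hull X" "y = v *\<^sub>R x + (1 - v) *\<^sub>R e"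
    using *[OF assms(2)] by blast
  show ?thesis
  proof (cases "u * v = 1")
    case True
    then have "u = 1" using u v by (smt (verit) mult_left_le)
    then show ?thesis using u by simp
  next
    case False
    then have *: "1 - u * v > 0" using u v by (smt (verit) mult_le_one)
    have "(1 - u * v) *\<^sub>R x = (u * (1 - v)) *\<^sub>R e + (1 - u) *\<^sub>R c"
    proof -
      have "x = u *\<^sub>R (v *\<^sub>R x + (1 - v) *\<^sub>R e) + (1 - u) *\<^sub>R c" using u(4) v(4) by simp
      then show ?thesis by (simp add: algebra_simps)
    qed
    then have "(1 / (1 - u * v)) *\<^sub>R ((1 - u * v) *\<^sub>R x) =
        (1 / (1 - u * v)) *\<^sub>R ((u * (1 - v)) *\<^sub>R e + (1 - u) *\<^sub>R c)" by simp
    then have "x = (u * (1 - v) / (1 - u * v)) *\<^sub>R e + ((1 - u) / (1 - u * v)) *\<^sub>R c"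
      using * by (simp add: scaleR_add_right)
    moreover have "u * (1 - v) / (1 - u * v) + (1 - u) / (1 - u * v) = 1"
      using * by (simp add: add_divide_distrib[symmetric]) (simp add: algebra_simps)
    moreover have "0 \<le> u * (1 - v) / (1 - u * v)" "0 \<le> (1 - u) / (1 - u * v)"
      using u(1,2) v(1,2) * by simp_all
    ultimately have "x \<in> convex hull X"
      using convexD[OF convex_convex_hull v(3) u(3)] by metis
    then show ?thesis ..
  qed
qed

text \<open>Among the lattice points outside \<open>X\<close> in the hull of \<open>X\<close> and
  \<open>z\<close>, take a \<open>y\<close> for which the hull of \<open>X\<close> and
  \<open>y\<close> has the fewest lattice points. A further lattice point \<open>t\<close> in that
  hull would generate a smaller one, because by antisymmetry \<open>y\<close> is missing from the
  hull of \<open>X\<close> and \<open>t\<close>.\<close>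

lemma exists_observer:
  assumes "finite X" "X \<noteq> {}" "lattice_convex d X" "z \<in> int_lattice d - X"
  shows "\<exists>y \<in> observers d X. y \<in> convex hull (insert z X)"
proof -
  define N where "N y = card (convex hull (insert y X) \<inter> int_lattice d)" for y
  define S where "S = {y \<in> int_lattice d - X. y \<in> convex hull (insert z X)}"
  have "z \<in> S" using assms(4) by (simp add: S_def hull_inc)
  then obtain y where y: "y \<in> S" "\<And>t. t \<in> S \<Longrightarrow> N y \<le> N t"
    using ex_has_least_nat[of "\<lambda>y. y \<in> S" z N] by blast
  have hull_sub: "convex hull (insert t X) \<subseteq> convex hull (insert y X)" if "t \<in> convex hull (insert y X)" for t y
    using that by (intro hull_minimal) (auto simp: hull_inc)
  have notin: "t \<notin> convex hull X" if "t \<in> S" for t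
    using that assms(3) unfolding S_def lattice_convex_def by blast
  have "t = y" if t: "t \<in> convex hull (insert y X)" "t \<in> int_lattice d" "t \<notin> X" for t
  proof (rule ccontr)
    assume "t \<noteq> y"
    have "t \<in> S" using t y(1) hull_sub[of y z] by (auto simp: S_def)
    have "y \<notin> convex hull (insert t X)"
      using hull_insert_antisym[OF _ t(1) assms(2)] notin[OF y(1)] \<open>t \<noteq> y\<close> by blast
    then have "convex hull (insert t X) \<inter> int_lattice d \<subset> convex hull (insert y X) \<inter> int_lattice d"
      using hull_sub[OF t(1)] y(1) by (auto simp: S_def hull_inc)
    then have "N t < N y"
      unfolding N_def using assms(1) by (intro psubset_card_mono finite_hull_lattice) auto
    then show False using y(2)[OF \<open>t \<in> S\<close>] by simp
  qed
  moreover have "insert y X \<subseteq> convex hull (insert y X) \<inter> int_lattice d"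
    using y(1) assms(3) by (auto simp: S_def lattice_convex_def hull_inc)
  ultimately have "y \<in> observers d X"
    using y(1) by (auto simp: observers_def S_def)
  then show ?thesis using y(1) by (auto simp: S_def)
qed

subsection \<open>Integral separation\<close>

lemma rational_between:
  fixes A B :: "real set"
  assumes "finite A" "finite B" "\<And>a b. a \<in> A \<Longrightarrow> b \<in> B \<Longrightarrow> a < b"
  shows "\<exists>r\<in>\<rat>. (\<forall>a\<in>A. a < r) \<and> (\<forall>b\<in>B. r < b)"
proof -
  define l where "l = (if A = {} then if B = {} then 0 else Min B - 1 else Max A)"
  define u where "u = (if B = {} then l + 1 else Min B)"
  have "l < u" 
  proof (cases "A = {} \<or> B = {}")
    case True
    then show ?thesis by (auto simp: l_def u_def simp del: Min_gr_iff Max_less_iff)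
  next
    case False
    then show ?thesis using assms by (simp add: l_def u_def)
  qed
  then obtain r where r: "r \<in> \<rat>" "l < r" "r < u" using Rats_dense_in_real by blast
  have "a < r" if "a \<in> A" for a
  proof -
    have "a \<le> l" using that assms(1) by (auto simp: l_def)
    then show ?thesis using r by simp
  qed
  moreover have "r < b" if "b \<in> B" for b
  proof -
    have "u \<le> b" using that assms(2) by (auto simp: u_def)
    then show ?thesis using r by simp
  qed
  ultimately show ?thesis using r by blast
qed

lemma common_denominator:
  fixes a :: "nat \<Rightarrow> real"
  assumes "\<And>i. i < d \<Longrightarrow> a i \<in> \<rat>"
  shows "\<exists>c::nat. c > 0 \<and> (\<forall>i<d. real c * a i \<in> \<int>)"
  using assms
proof (induction d)
  case (Suc d)
  then obtain c where c: "c > 0" "\<forall>i<d. real c * a i \<in> \<int>" by auto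
  obtain p q where pq: "q > 0" "a d = of_int p / of_int q"
    using Suc.prems[of d] by (auto elim: Rats_cases')
  have "real (c * nat q) * a i \<in> \<int>" if "i < Suc d" for i
  proof (cases "i = d")
    case True
    have "real (c * nat q) * a d = of_int (int c * p)" using pq by simp
    then show ?thesis using True by (metis Ints_of_int)
  next
    case False
    then have "real (c * nat q) * a i = of_int q * (real c * a i)" "real c * a i \<in> \<int>"
      using that c pq(1) by auto
    then show ?thesis by (metis Ints_mult Ints_of_int)
  qed
  then show ?case using c pq(1) by (intro exI[of _ "c * nat q"]) auto
qed auto

text \<open>Nonzero combinations with natural coefficients. The empty sum is left out, so that zero
  belongs to the set only through a nontrivial combination, as the alternative in Gordan's theorem
  demands.\<close>

inductive_set semigroup_hull :: "point set \<Rightarrow> point set" for S where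
  base: "s \<in> S \<Longrightarrow> s \<in> semigroup_hull S"
| plus: "s \<in> semigroup_hull S \<Longrightarrow> t \<in> semigroup_hull S \<Longrightarrow> s + t \<in> semigroup_hull S"

lemma semigroup_hull_scale:
  assumes "s \<in> semigroup_hull S" "n > 0"
  shows "(\<lambda>i. real n * s i) \<in> semigroup_hull S"
  using assms(2)
proof (induction n rule: nat_induct_non_zero)
  case 1
  then show ?case using assms(1) by simp
next
  case (Suc n)
  have "(\<lambda>i. real (Suc n) * s i) = (\<lambda>i. real n * s i) + s"
    by (auto simp: algebra_simps)
  then show ?case using Suc assms(1) by (simp only: semigroup_hull.plus)
qed

lemma semigroup_hull_list:
  assumes "w \<in> semigroup_hull S"
  shows "\<exists>L. L \<noteq> [] \<and> set L \<subseteq> S \<and> w = sum_list L"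
  using assms
proof induction
  case (base s)
  then show ?case by (intro exI[of _ "[s]"]) auto
next
  case (plus s t)
  then obtain L K where "L \<noteq> []" "set L \<subseteq> S" "s = sum_list L" "set K \<subseteq> S" "t = sum_list K" by blast
  then show ?case by (intro exI[of _ "L @ K"]) auto
qed

text \<open>Fourier--Motzkin elimination; since it only forms positive integral combinations, the
  certificate of infeasibility is integral, too.\<close>

lemma gordan_rational:
  assumes "finite S" "\<And>s i. s \<in> S \<Longrightarrow> s i \<in> \<int>"
  shows "(\<exists>a. (\<forall>i. a i \<in> \<rat>) \<and> (\<forall>s\<in>S. 0 < dotp d a s)) \<or> (\<exists>w\<in>semigroup_hull S. \<forall>i<d. w i = 0)"
  using assms
proof (induction d arbitrary: S)
  case 0
  show ?case
  proof (cases "S = {}")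
    case True
    then show ?thesis by (intro disjI1 exI[of _ "\<lambda>_. 0"]) auto
  next
    case False
    then show ?thesis by (auto intro: semigroup_hull.base)
  qed
next
  case (Suc d)
  define P where "P = {s\<in>S. s d > 0}"
  define N where "N = {s\<in>S. s d < 0}"
  \<comment> \<open>Coordinate \<open>d\<close> cancels in \<open>comb p n\<close>, and the
    multipliers \<open>p d\<close> and \<open>- n d\<close> are positive integers.\<close>
  define comb :: "point \<Rightarrow> point \<Rightarrow> point" where "comb p n = (\<lambda>i. p d * n i - n d * p i)" for p n
  define T where "T = {s\<in>S. s d = 0} \<union> (\<lambda>(p, n). comb p n) ` (P \<times> N)"
  have fin: "finite P" "finite N" "finite T" using Suc.prems(1) by (simp_all add: P_def N_def T_def)
  have Td: "t d = 0" if "t \<in> T" for t using that by (auto simp: T_def comb_def)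
  have Tint: "t i \<in> \<int>" if "t \<in> T" for t i
    using that Suc.prems(2) by (auto simp: T_def comb_def P_def N_def)
  have T_sub: "T \<subseteq> semigroup_hull S"
  proof -
    have "comb p n \<in> semigroup_hull S" if "p \<in> P" "n \<in> N" for p n
    proof -
      have pn: "p \<in> S" "n \<in> S" "p d > 0" "n d < 0" using that by (auto simp: P_def N_def)
      then obtain k l where kl: "p d = of_int k" "n d = of_int l" using Suc.prems(2) by (meson Ints_cases)
      have "comb p n = (\<lambda>i. real (nat k) * n i) + (\<lambda>i. real (nat (- l)) * p i)"
        using kl pn(3,4) by (auto simp: comb_def)
      moreover have "(\<lambda>i. real (nat k) * n i) \<in> semigroup_hull S" "(\<lambda>i. real (nat (- l)) * p i) \<in> semigroup_hull S"
        using kl pn by (intro semigroup_hull_scale semigroup_hull.base; simp)+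
      ultimately show ?thesis by (simp only: semigroup_hull.plus)
    qed
    then show ?thesis by (auto simp: T_def intro: semigroup_hull.base)
  qed
  have "(\<exists>a. (\<forall>i. a i \<in> \<rat>) \<and> (\<forall>s\<in>T. 0 < dotp d a s)) \<or> (\<exists>w\<in>semigroup_hull T. \<forall>i<d. w i = 0)"
    by (rule Suc.IH) (use fin Tint in auto)
  then show ?case
  proof
    assume "\<exists>w\<in>semigroup_hull T. \<forall>i<d. w i = 0"
    then obtain w where w: "w \<in> semigroup_hull T" "\<forall>i<d. w i = 0" by blast
    from w(1) have "w \<in> semigroup_hull S \<and> w d = 0"
    proof induction
      case (base s)
      then show ?case using T_sub Td by blast
    next
      case (plus s t)
      then have "(s + t) d = 0" by simp
      then show ?case using plus semigroup_hull.plus by blast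
    qed
    then show ?thesis using w(2) by (auto simp: less_Suc_eq)
  next
    assume "\<exists>a. (\<forall>i. a i \<in> \<rat>) \<and> (\<forall>s\<in>T. 0 < dotp d a s)"
    then obtain a where a: "\<And>i. a i \<in> \<rat>" "\<And>s. s \<in> T \<Longrightarrow> 0 < dotp d a s" by blast
    \<comment> \<open>The last coefficient \<open>r\<close> must exceed the left side for all
      \<open>p\<close> and stay below the right side for all \<open>n\<close>. Positivity of
      \<open>a\<close> on \<open>comb p n\<close> says precisely that these bounds are
      compatible.\<close>
    have "- dotp d a p / p d < dotp d a n / - n d" if "p \<in> P" "n \<in> N" for p n
    proof -
      have "0 < dotp d a (comb p n)" using that by (intro a(2)) (auto simp: T_def)
      also have "dotp d a (comb p n) = p d * dotp d a n - n d * dotp d a p"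
        by (simp add: dotp_def comb_def algebra_simps sum_subtractf sum_distrib_left)
      finally show ?thesis using that by (simp add: P_def N_def field_simps)
    qed
    then have "\<exists>r\<in>\<rat>. (\<forall>c\<in>(\<lambda>p. - dotp d a p / p d) ` P. c < r) \<and> (\<forall>c\<in>(\<lambda>n. dotp d a n / - n d) ` N. r < c)"
      using fin by (intro rational_between) blast+
    then obtain r where r: "r \<in> \<rat>" "\<And>p. p \<in> P \<Longrightarrow> - dotp d a p / p d < r" "\<And>n. n \<in> N \<Longrightarrow> r < dotp d a n / - n d"
      by blast
    have dotp_Suc: "dotp (Suc d) (a(d := r)) s = dotp d a s + r * s d" for s
      by (simp add: dotp_def)
    have "0 < dotp (Suc d) (a(d := r)) s" if s: "s \<in> S" for s
    proof -
      consider "s d = 0" | "s \<in> P" | "s \<in> N"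
        using s unfolding P_def N_def by fastforce
      then show ?thesis
      proof cases
        case 1
        then show ?thesis using a(2)[of s] s by (simp add: dotp_Suc T_def)
      next
        case 2
        then show ?thesis using r(2)[of s] by (simp add: dotp_Suc P_def field_simps)
      next
        case 3
        then show ?thesis using r(3)[of s] by (simp add: dotp_Suc N_def field_simps)
      qed
    qed
    moreover have "(a(d := r)) i \<in> \<rat>" for i using a(1) r(1) by simp
    ultimately show ?thesis by blast
  qed
qed

text \<open>Gordan's alternative for the differences \<open>y - x\<close>. Clearing denominators
  makes the normal vector integral; multiplicities in a vanishing combination become repetitions in
  the list.\<close>

lemma integral_separation:
  assumes "finite X" "finite Y" "X \<subseteq> int_lattice d" "Y \<subseteq> int_lattice d"
  shows "(\<exists>a\<in>int_lattice d. \<forall>x\<in>X. \<forall>y\<in>Y. dotp d a x < dotp d a y) \<or>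
    (\<exists>L. L \<noteq> [] \<and> set L \<subseteq> X \<times> Y \<and> sum_list (map (\<lambda>(x, y). y - x) L) = 0)"
proof -
  define f where "f = (\<lambda>(x :: point, y). y - x)"
  define S where "S = f ` (X \<times> Y)"
  have "finite S" using assms by (simp add: S_def)
  moreover have "s i \<in> \<int>" if "s \<in> S" for s i
    using that assms(3,4) by (fastforce simp: S_def f_def int_lattice_iff)
  ultimately consider (a) a where "\<And>i. a i \<in> \<rat>" "\<And>s. s \<in> S \<Longrightarrow> 0 < dotp d a s"
    | (w) w where "w \<in> semigroup_hull S" "\<And>i. i < d \<Longrightarrow> w i = 0"
    using gordan_rational[of S d] by blast
  then show ?thesis
  proof cases
    case a
    then obtain c where c: "c > 0" "\<forall>i<d. real c * a i \<in> \<int>" using common_denominator[of d a] by blast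
    define b where "b = (\<lambda>i. if i < d then real c * a i else 0)"
    have "b \<in> int_lattice d" using c by (auto simp: b_def int_lattice_iff)
    moreover have "dotp d b x < dotp d b y" if "x \<in> X" "y \<in> Y" for x y
    proof -
      have "dotp d b s = real c * dotp d a s" for s
        by (simp add: dotp_def b_def sum_distrib_left mult_ac)
      moreover have "0 < dotp d a (y - x)" using that by (intro a(2)) (force simp: S_def f_def)
      ultimately show ?thesis using c(1) by (simp add: dotp_diff)
    qed
    ultimately show ?thesis by blast
  next
    case w
    then obtain K where K: "K \<noteq> []" "set K \<subseteq> f ` (X \<times> Y)" "w = sum_list K"
      using semigroup_hull_list unfolding S_def by blast
    have "K \<in> map f ` lists (X \<times> Y)"
      using K(2) by (simp add: lists_image[symmetric] in_lists_conv_set subset_iff)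
    then obtain L where L: "K = map f L" "set L \<subseteq> X \<times> Y"
      by (auto simp: in_lists_conv_set)
    have "w i = 0" for i
    proof (cases "i < d")
      case False
      have "z i = 0" if "z \<in> set K" for z
        using that K(2) assms(3,4) False by (fastforce simp: f_def int_lattice_iff)
      then have "sum_list K i = 0" by (induction K) auto
      then show ?thesis using K(3) by simp
    qed (use w in auto)
    then have "w = 0" by auto
    then show ?thesis using K L unfolding f_def by (intro disjI2 exI[of _ L]) auto
  qed
qed

text \<open>If the second set is a single point, a vanishing sum of \<open>n\<close> differences
  exhibits this point as the average of \<open>n\<close> points of \<open>X\<close>.\<close>

lemma separation_from_hull:
  assumes "finite X" "X \<subseteq> int_lattice d" "z \<in> int_lattice d" "z \<notin> convex hull X"
  shows "\<exists>a\<in>int_lattice d. \<forall>x\<in>X. dotp d a x < dotp d a z"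
proof (rule ccontr)
  assume "\<not> ?thesis"
  then obtain L where L: "L \<noteq> []" "set L \<subseteq> X \<times> {z}" "sum_list (map (\<lambda>(x, y). y - x) L) = 0"
    using integral_separation[of X "{z}" d] assms by auto
  define n where "n = length L"
  have n: "n > 0" using L(1) by (simp add: n_def)
  have mem: "fst (L ! i) \<in> X" "snd (L ! i) = z" if "i < n" for i
    using L(2) that by (force simp: n_def dest: nth_mem)+
  have "0 = (\<Sum>i<n. snd (L ! i) - fst (L ! i))"
    using L(3) by (simp add: sum_list_sum_nth n_def case_prod_unfold atLeast0LessThan)
  also have "\<dots> = (\<Sum>i<n. z - fst (L ! i))" using mem by (intro sum.cong) auto
  also have "\<dots> = real n *\<^sub>R z - (\<Sum>i<n. fst (L ! i))"
    by (simp add: sum_subtractf sum_constant_scaleR del: sum_constant)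
  finally have "(1 / real n) *\<^sub>R (real n *\<^sub>R z) = (1 / real n) *\<^sub>R (\<Sum>i<n. fst (L ! i))" by simp
  then have "z = (\<Sum>i<n. (1 / real n) *\<^sub>R fst (L ! i))"
    using n by (simp add: scaleR_sum_right)
  also have "\<dots> \<in> convex hull X"
    using n mem by (intro convex_sum) (auto simp: hull_inc)
  finally show False using assms(4) by simp
qed

subsection \<open>Full-dimensionality and finiteness of the set of observers\<close>

lemma int_latticeD: "x \<in> int_lattice d \<Longrightarrow> x i \<in> \<int>" "x \<in> int_lattice d \<Longrightarrow> i \<ge> d \<Longrightarrow> x i = 0"
  by (auto simp: int_lattice_iff)

lemma int_lattice_closed:
  assumes "x \<in> int_lattice d" "y \<in> int_lattice d"
  shows "x + y \<in> int_lattice d" "x - y \<in> int_lattice d"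
  using assms by (auto simp: int_lattice_iff)

lemma dotp_Ints: "u \<in> int_lattice d \<Longrightarrow> x \<in> int_lattice d \<Longrightarrow> dotp d u x \<in> \<int>"
  unfolding dotp_def by (intro Ints_sum Ints_mult) (auto simp: int_lattice_iff)

text \<open>For nonempty \<open>X\<close> this means that \<open>X\<close> affinely spans the space.
  The dual formulation is the one that trivialises equations valid on \<open>X\<close>.\<close>

definition nondegenerate :: "nat \<Rightarrow> point set \<Rightarrow> bool"
  where "nondegenerate d X \<longleftrightarrow> (\<forall>u c. (\<forall>x\<in>X. dotp d u x = c) \<longrightarrow> (\<forall>i<d. u i = 0))"

lemma nondegenerateD:
  "nondegenerate d X \<Longrightarrow> (\<And>x. x \<in> X \<Longrightarrow> dotp d u x = c) \<Longrightarrow> i < d \<Longrightarrow> u i = 0"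
  unfolding nondegenerate_def by blast

text \<open>Simultaneous Dirichlet approximation replaces a real normal vector of \<open>X\<close> by an integral one.\<close>

lemma nondegenerate_if_integral:
  assumes "finite X" "X \<noteq> {}" "X \<subseteq> int_lattice d"
    and *: "\<And>u c. u \<in> int_lattice d \<Longrightarrow> (\<forall>x\<in>X. dotp d u x = c) \<Longrightarrow> u = 0"
  shows "nondegenerate d X"
  unfolding nondegenerate_def
proof (intro allI impI, rule ccontr)
  fix u c i0
  assume c: "\<forall>x\<in>X. dotp d u x = c" and i0: "i0 < d" "u i0 \<noteq> 0"
  obtain B where B: "B \<ge> 0" "\<And>x i. x \<in> X \<Longrightarrow> i < d \<Longrightarrow> \<bar>x i\<bar> \<le> B"
    using finite_coord_bound[OF assms(1)] by metis
  \<comment> \<open>The first summand makes the integer \<open>dotp d w (x - y)\<close> smaller than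
    1 in absolute value, hence zero; the second excludes that \<open>u i0\<close> is approximated by
    0.\<close>
  obtain N :: nat where N: "real N > 2 * B * d + 1 / \<bar>u i0\<bar>" using reals_Archimedean2 by blast
  moreover have u0: "0 < 1 / \<bar>u i0\<bar>" using i0 by simp
  moreover have "0 \<le> 2 * B * d" using B(1) by simp
  ultimately have "N > 0" "real N > 2 * B * d" "real N > 1 / \<bar>u i0\<bar>" by (simp_all, linarith+)
  from Dirichlet_approx_simult[OF \<open>N > 0\<close>, of d u]
  obtain q p where qp: "0 < q" "\<And>i. i < d \<Longrightarrow> \<bar>of_int q * u i - of_int (p i)\<bar> < 1 / real N" by metis
  define w :: point where "w = (\<lambda>i. if i < d then of_int (p i) else 0)"
  have w: "w \<in> int_lattice d" by (auto simp: w_def int_lattice_iff)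
  have const: "dotp d w (x - y) = 0" if "x \<in> X" "y \<in> X" for x y
  proof -
    have "dotp d u (x - y) = 0" using c that by (simp add: dotp_diff)
    then have "dotp d w (x - y) = dotp d w (x - y) - of_int q * dotp d u (x - y)" by simp
    also have "\<dots> = (\<Sum>i<d. (w i - of_int q * u i) * (x i - y i))"
      by (simp add: dotp_def sum_distrib_left sum_subtractf sum.distrib algebra_simps)
    also have "\<bar>\<dots>\<bar> \<le> (\<Sum>i<d. 1 / real N * (2 * B))"
    proof (intro order_trans[OF sum_abs] sum_mono)
      fix i assume "i \<in> {..<d}"
      then have "\<bar>w i - of_int q * u i\<bar> \<le> 1 / real N" "\<bar>x i - y i\<bar> \<le> 2 * B"
        using qp(2)[of i] B(2)[OF \<open>x \<in> X\<close>, of i] B(2)[OF \<open>y \<in> X\<close>, of i] by (auto simp: w_def)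
      then show "\<bar>(w i - of_int q * u i) * (x i - y i)\<bar> \<le> 1 / real N * (2 * B)"
        unfolding abs_mult by (intro mult_mono) auto
    qed
    also have "\<dots> = 2 * B * d / real N" by simp
    also have "\<dots> < 1" using \<open>real N > 2 * B * d\<close> \<open>N > 0\<close> by simp
    finally have "\<bar>dotp d w (x - y)\<bar> < 1" .
    moreover have "dotp d w (x - y) \<in> \<int>"
      using that assms(3) by (intro dotp_Ints w int_lattice_closed) auto
    ultimately show ?thesis by (auto elim!: Ints_cases)
  qed
  obtain x0 where "x0 \<in> X" using assms(2) by blast
  then have "\<forall>x\<in>X. dotp d w x = dotp d w x0" using const dotp_diff[of d w _ x0] by (metis eq_iff_diff_eq_0)
  from *[OF w this] have "w i0 = 0" by simp
  then have "p i0 = 0" using i0(1) by (simp add: w_def)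
  then have "of_int q * \<bar>u i0\<bar> < 1 / real N" using qp(2)[OF i0(1)] qp(1) by (simp add: abs_mult)
  moreover have "1 * \<bar>u i0\<bar> \<le> of_int q * \<bar>u i0\<bar>" using qp(1) by (intro mult_right_mono) auto
  ultimately have "\<bar>u i0\<bar> < 1 / real N" by simp
  then show False using \<open>real N > 1 / \<bar>u i0\<bar>\<close> \<open>N > 0\<close> i0 by (simp add: field_simps)
qed

text \<open>Infinite descent: let an integral form be constant on \<open>X\<close>. On a point of
  \<open>X\<close> congruent to 0 its value is even, on one congruent to the \<open>i\<close>-th
  unit vector it has the parity of the coefficient \<open>u i\<close>. Hence all coefficients are
  even, and half of the form is again integral and constant on \<open>X\<close>.\<close>

lemma parity_nondegenerate:
  assumes "finite X" "X \<subseteq> int_lattice d" "parity_complete d X"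
  shows "nondegenerate d X"
proof (rule nondegenerate_if_integral[OF assms(1) _ assms(2)])
  have "0 \<in> int_lattice d" by (simp add: int_lattice_iff)
  then show "X \<noteq> {}" using assms(3) by (auto simp: parity_complete_def)
next
  fix u c
  assume "u \<in> int_lattice d" "\<forall>x\<in>X. dotp d u x = c"
  moreover have "u j = 0" if "u \<in> int_lattice d" "\<forall>x\<in>X. dotp d u x = c" "j < d" for u c j
    using that
  proof (induction "nat \<lfloor>\<bar>u j\<bar>\<rfloor>" arbitrary: u c rule: less_induct)
    case less
    have half: "u i / 2 \<in> \<int>" for i
    proof (cases "i < d")
      case True
      define e :: point where "e = (\<lambda>k. if k = i then 1 else 0)"
      have "0 \<in> int_lattice d" "e \<in> int_lattice d" using True by (auto simp: int_lattice_iff e_def)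
      then obtain x0 y0 x1 y1 where x: "x0 \<in> X" "y0 \<in> int_lattice d" "x0 = 2 *\<^sub>R y0"
        "x1 \<in> X" "y1 \<in> int_lattice d" "x1 - e = 2 *\<^sub>R y1"
        using assms(3) unfolding parity_complete_def by (metis diff_zero)
      have "dotp d u x0 = dotp d u x1" using less.prems(2) x by metis
      moreover have "dotp d u x0 = 2 * dotp d u y0" using x by (simp add: dotp_scaleR)
      moreover have "dotp d u x1 = u i + 2 * dotp d u y1"
      proof -
        have "dotp d u (x1 - e) = 2 * dotp d u y1" using x by (simp add: dotp_scaleR)
        moreover have "dotp d u e = u i" using True
          by (simp add: dotp_def e_def if_distrib[of "\<lambda>c. _ * c"] cong: if_cong)
        ultimately show ?thesis by (simp add: dotp_diff)
      qed
      ultimately have "u i / 2 = dotp d u y0 - dotp d u y1" by simp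
      then show ?thesis using x less.prems(1) by (simp only:) (intro Ints_diff dotp_Ints)
    qed (use int_latticeD(2)[OF less.prems(1)] in auto)
    define v :: point where "v = (\<lambda>i. u i / 2)"
    show ?case
    proof (rule ccontr)
      assume "u j \<noteq> 0"
      moreover have "u j \<in> \<int>" using int_latticeD less.prems by blast
      ultimately obtain k where k: "u j = of_int k" "k \<noteq> 0" by (auto elim: Ints_cases)
      have "v j \<in> \<int>" using half unfolding v_def .
      then obtain l where l: "v j = of_int l" by (auto elim: Ints_cases)
      have "k = 2 * l" using k l by (simp add: v_def; linarith)
      moreover have "\<lfloor>\<bar>u j\<bar>\<rfloor> = \<bar>k\<bar>" "\<lfloor>\<bar>v j\<bar>\<rfloor> = \<bar>l\<bar>"
        unfolding k l of_int_abs[symmetric] by (rule floor_of_int)+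
      ultimately have "nat \<lfloor>\<bar>v j\<bar>\<rfloor> < nat \<lfloor>\<bar>u j\<bar>\<rfloor>" using k(2) by simp
      moreover have "v \<in> int_lattice d" using half less.prems(1) by (auto simp: v_def int_lattice_iff)
      moreover have "\<forall>x\<in>X. dotp d v x = c / 2"
        using less.prems(2) by (simp add: dotp_def v_def sum_divide_distrib[symmetric])
      ultimately have "v j = 0" using less.hyps less.prems(3) by blast
      then show False using \<open>u j \<noteq> 0\<close> by (simp add: v_def)
    qed
  qed
  ultimately have "u i = 0" for i using int_latticeD(2)[of u d i] by (cases "i < d") (blast, simp)
  then show "u = 0" by auto
qed

text \<open>The midpoint of an observer \<open>z\<close> and a point \<open>x\<close> of
  \<open>X\<close> in its parity class is a lattice point of the enlarged hull. It differs from
  \<open>z\<close> because \<open>x\<close> does, so it lies in \<open>X\<close> and determines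
  \<open>z\<close> together with \<open>x\<close>.\<close>

lemma parity_finite_observers:
  assumes "finite X" "X \<subseteq> int_lattice d" "parity_complete d X"
  shows "finite (observers d X)"
proof (rule finite_subset)
  show "finite ((\<lambda>(x, y). 2 *\<^sub>R y - x) ` (X \<times> X))" using assms(1) by simp
  show "observers d X \<subseteq> (\<lambda>(x, y). 2 *\<^sub>R y - x) ` (X \<times> X)"
  proof
    fix z assume z: "z \<in> observers d X"
    then have zl: "z \<in> int_lattice d" "z \<notin> X" by (auto simp: observers_def)
    obtain x y where x: "x \<in> X" "y \<in> int_lattice d" "x - z = 2 *\<^sub>R y"
      using assms(3) zl unfolding parity_complete_def by blast
    have m: "y + z = (1/2) *\<^sub>R x + (1/2) *\<^sub>R z"
    proof -
      have "x = z + 2 *\<^sub>R y" using x(3) by (simp add: algebra_simps)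
      then show ?thesis by (simp add: algebra_simps flip: scaleR_left_distrib)
    qed
    have "y + z \<in> convex hull (insert z X)"
      unfolding m using x(1) by (intro convexD convex_convex_hull) (auto simp: hull_inc)
    moreover have "y + z \<in> int_lattice d" using x zl by (intro int_lattice_closed)
    ultimately have "y + z \<in> insert z X" using z unfolding observers_def by blast
    moreover have "y + z \<noteq> z"
    proof
      assume "y + z = z"
      then have "y = 0" by (metis add_cancel_left_left)
      then show False using x zl by simp
    qed
    ultimately have "y + z \<in> X" by blast
    moreover have "z = 2 *\<^sub>R (y + z) - x"
      unfolding m by (simp add: algebra_simps flip: scaleR_left_distrib)
    ultimately show "z \<in> (\<lambda>(x, y). 2 *\<^sub>R y - x) ` (X \<times> X)" using x(1) by (intro image_eqI[of _ _ "(x, y + z)"]) auto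
  qed
qed

lemma interior_of_Euclidean_space_cube:
  assumes "p \<in> Euclidean_space d interior_of S"
  obtains r where "r > 0" "\<And>x. x \<in> topspace (Euclidean_space d) \<Longrightarrow> (\<And>i. i < d \<Longrightarrow> \<bar>x i - p i\<bar> < r) \<Longrightarrow> x \<in> S"
proof -
  obtain T where T: "openin (Euclidean_space d) T" "p \<in> T" "T \<subseteq> S"
    using assms by (auto simp: interior_of_def)
  then obtain U where U: "openin (powertop_real UNIV) U" "T = U \<inter> {x. \<forall>i\<ge>d. x i = 0}"
    by (auto simp: Euclidean_space_def openin_subtopology)
  obtain V where V: "p \<in> (\<Pi>\<^sub>E i\<in>UNIV. V i)" "\<And>i. open (V i)" "(\<Pi>\<^sub>E i\<in>UNIV. V i) \<subseteq> U"
    using product_topology_open_contains_basis[OF U(1), of p] T(2) U(2) by auto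
  have "\<forall>i. \<exists>e>0. \<forall>t. \<bar>t - p i\<bar> < e \<longrightarrow> t \<in> V i"
    using V(1,2) unfolding open_real by auto
  then obtain e where e: "\<And>i. e i > 0" "\<And>i t. \<bar>t - p i\<bar> < e i \<Longrightarrow> t \<in> V i" by metis
  \<comment> \<open>The 1 keeps the minimum meaningful for \<open>d = 0\<close>.\<close>
  define r where "r = Min (insert 1 (e ` {..<d}))"
  have r: "r > 0" "\<And>i. i < d \<Longrightarrow> r \<le> e i" using e(1) by (auto simp: r_def)
  have p: "p i = 0" if "i \<ge> d" for i using T(2) U(2) that by auto
  show thesis
  proof
    fix x assume x: "x \<in> topspace (Euclidean_space d)" "\<And>i. i < d \<Longrightarrow> \<bar>x i - p i\<bar> < r"
    have "x i \<in> V i" for i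
    proof (cases "i < d")
      case True
      then show ?thesis using x(2)[of i] r(2)[of i] by (intro e(2)) auto
    next
      case False
      then show ?thesis using x(1) p[of i] e(1)[of i] by (intro e(2)) (auto simp: in_topspace_iff)
    qed
    then have "x \<in> U" using V(3) by auto
    then show "x \<in> S" using x(1) T(3) U(2) by (auto simp: in_topspace_iff)
  qed (rule r(1))
qed

lemma interior_nondegenerate:
  assumes "X \<subseteq> int_lattice d" "has_interior_lattice_point d X"
  shows "nondegenerate d X"
  unfolding nondegenerate_def
proof (intro allI impI)
  fix u c i
  assume c: "\<forall>x\<in>X. dotp d u x = c" and i: "i < d"
  obtain p where p: "p \<in> Euclidean_space d interior_of (convex hull X)" "p \<in> int_lattice d"
    using assms(2) by (auto simp: has_interior_lattice_point_def)
  obtain r where r: "r > 0" "\<And>x. x \<in> topspace (Euclidean_space d) \<Longrightarrow> (\<And>i. i < d \<Longrightarrow> \<bar>x i - p i\<bar> < r) \<Longrightarrow> x \<in> convex hull X"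
    using interior_of_Euclidean_space_cube[OF p(1)] by blast
  define e :: point where "e = (\<lambda>k. if k = i then r / 2 else 0)"
  have "p \<in> convex hull X" "p + e \<in> convex hull X"
    using r i p(2) by (auto intro!: r(2) simp: e_def in_topspace_iff int_lattice_iff)
  moreover have "convex hull X \<subseteq> {x. dotp d u x = c}"
    using c by (intro hull_minimal convex_dotp_eq) auto
  ultimately have "dotp d u p = c" "dotp d u (p + e) = c" by blast+
  then have "dotp d u e = 0" using dotp_add[of d u p e] by linarith
  then show "u i = 0" using i r(1)
    by (simp add: dotp_def e_def if_distrib[of "\<lambda>c. _ * c"] cong: if_cong)
qed

text \<open>Suppose \<open>z\<close> is far from the interior lattice point \<open>p\<close>. A
  lattice point \<open>y\<close> very close to the segment from \<open>p\<close> to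
  \<open>z\<close>, in its first half, is a combination of \<open>z\<close> and a point of the cube
  around \<open>p\<close>. If \<open>y\<close> is also too far from \<open>p\<close> to lie in
  \<open>X\<close> and too close to \<open>p\<close> to be \<open>z\<close>, then \<open>z\<close>
  is no observer.\<close>

lemma interior_finite_observers:
  assumes "finite X" "X \<subseteq> int_lattice d" "has_interior_lattice_point d X"
  shows "finite (observers d X)"
proof -
  obtain p where p: "p \<in> Euclidean_space d interior_of (convex hull X)" "p \<in> int_lattice d"
    using assms(3) by (auto simp: has_interior_lattice_point_def)
  obtain r where r: "r > 0" "\<And>x. x \<in> topspace (Euclidean_space d) \<Longrightarrow> (\<And>i. i < d \<Longrightarrow> \<bar>x i - p i\<bar> < r) \<Longrightarrow> x \<in> convex hull X"
    using interior_of_Euclidean_space_cube[OF p(1)] by blast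
  obtain B where B: "B \<ge> 0" "\<And>x i. x \<in> insert p X \<Longrightarrow> i < d \<Longrightarrow> \<bar>x i\<bar> \<le> B"
    using finite_coord_bound[of "insert p X"] assms(1) by (metis finite_insert)
  \<comment> \<open>The approximation error is below \<open>1 / N < r / 2\<close>; dividing by
    \<open>1 - t \<ge> 1 / 2\<close> at most doubles it, which keeps it inside the cube.\<close>
  obtain N :: nat where N: "real N > 2 / r" using reals_Archimedean2 by blast
  have "0 < 2 / r" using r(1) by simp
  then have N0: "N > 0" using N by (cases N) auto
  have Nr: "1 / real N < r / 2" using N N0 r(1) by (simp add: field_simps)
  have N1: "1 / real N \<le> 1" using N0 by simp
  \<comment> \<open>Points of \<open>X\<close> differ from \<open>p\<close> by at most
    \<open>2 * B\<close> in each coordinate, so a distance of more than \<open>L - 1\<close> leaves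
    \<open>X\<close>. As the multiplier \<open>q\<close> is at most \<open>N ^ d\<close>, a distance
    beyond \<open>T\<close> places \<open>y\<close> in the first half of the segment and keeps it
    apart from \<open>z\<close>.\<close>
  define L where "L = 2 * B + 2"
  define T where "T = 2 * (real (N ^ d) * L) + 1"
  have L: "L \<ge> 2" using B(1) by (simp add: L_def)
  have N_pow: "real (N ^ d) \<ge> 1" using N0 by simp
  have NL: "real (N ^ d) * L \<ge> 2" using mult_mono[OF N_pow L] by simp
  have "\<bar>z i - p i\<bar> \<le> T" if z: "z \<in> observers d X" and i: "i < d" for z i
  proof (rule ccontr)
    assume "\<not> \<bar>z i - p i\<bar> \<le> T"
    define s where "s = Max ((\<lambda>i. \<bar>z i - p i\<bar>) ` {..<d})"
    have s_ge: "\<bar>z k - p k\<bar> \<le> s" if "k < d" for k using that by (simp add: s_def)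
    have "s \<in> (\<lambda>i. \<bar>z i - p i\<bar>) ` {..<d}" unfolding s_def using i by (intro Max_in) auto
    then obtain j where j: "j < d" "s = \<bar>z j - p j\<bar>" by auto
    have sT: "s > T" using s_ge[OF i] \<open>\<not> \<bar>z i - p i\<bar> \<le> T\<close> by simp
    have s0: "s > 0" using sT NL by (simp add: T_def)
    \<comment> \<open>The direction from \<open>p\<close> to \<open>z\<close> is scaled to maximum
      norm \<open>L\<close> before it is approximated, so that even \<open>q = 1\<close> gives a
      step of length about \<open>L\<close>.\<close>
    from Dirichlet_approx_simult[OF N0, of d "\<lambda>k. L * (z k - p k) / s"]
    obtain q w where q: "0 < q" "q \<le> int (N ^ d)"
      and w: "\<And>k. k < d \<Longrightarrow> \<bar>of_int q * (L * (z k - p k) / s) - of_int (w k)\<bar> < 1 / real N"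
      by metis
    have qN: "real_of_int q \<le> real (N ^ d)" using q(2) by (metis of_int_le_iff of_int_of_nat_eq)
    define y :: point where "y = (\<lambda>k. p k + (if k < d then of_int (w k) else 0))"
    have y: "y \<in> int_lattice d" using p(2) by (auto simp: y_def int_lattice_iff)
    define t where "t = of_int q * L / s"
    have qL: "of_int q * L \<le> real (N ^ d) * L" "1 * L \<le> of_int q * L"
      using qN q(1) L by (intro mult_right_mono; simp)+
    have "of_int q * L \<le> s / 2" using qL(1) sT by (simp add: T_def)
    then have t: "0 \<le> t" "t \<le> 1 / 2"
      using s0 q(1) L by (auto simp: t_def field_simps)
    define e :: point where "e = (\<lambda>k. y k - p k - t * (z k - p k))"
    have zp: "z k = 0" "p k = 0" "y k = 0" if "k \<ge> d" for k
      using z p(2) y that by (auto simp: observers_def int_lattice_iff)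
    have e_less: "\<bar>e k\<bar> < 1 / real N" if "k < d" for k
      using w[OF that] that by (simp add: e_def y_def t_def abs_minus_commute)
    \<comment> \<open>Solved from \<open>y = t *\<^sub>R z + (1 - t) *\<^sub>R f\<close>: the whole
      error of \<open>y\<close> is shifted to the endpoint \<open>p\<close>.\<close>
    define f :: point where "f = (\<lambda>k. p k + e k / (1 - t))"
    have "f \<in> convex hull X"
    proof (rule r(2))
      show "f \<in> topspace (Euclidean_space d)" using zp by (auto simp: f_def e_def in_topspace_iff)
      fix k assume "k < d"
      have "\<bar>e k\<bar> / (1 - t) \<le> \<bar>e k\<bar> / (1 / 2)" using t by (intro divide_left_mono) auto
      also have "\<dots> < r" using e_less[OF \<open>k < d\<close>] Nr by simp
      finally show "\<bar>f k - p k\<bar> < r" using t by (simp add: f_def)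
    qed
    moreover have "y = t *\<^sub>R z + (1 - t) *\<^sub>R f"
    proof
      fix k
      have "(1 - t) * f k = (1 - t) * p k + e k" using t by (simp add: f_def distrib_left)
      then show "y k = (t *\<^sub>R z + (1 - t) *\<^sub>R f) k" by (simp add: scaleR_fun_def e_def algebra_simps)
    qed
    ultimately have "y \<in> convex hull (insert z X)"
      using t hull_mono[of X "insert z X" convex]
      by (auto intro!: convexD[OF convex_convex_hull] simp: hull_inc)
    then have "y \<in> insert z X" using z y by (auto simp: observers_def)
    moreover have tz: "\<bar>t * (z j - p j)\<bar> = of_int q * L"
      using j s0 q(1) L by (simp add: t_def abs_mult)
    have "y \<notin> X"
    proof
      assume "y \<in> X"
      then have "\<bar>y j\<bar> \<le> B" "\<bar>p j\<bar> \<le> B" using B(2) j(1) by auto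
      moreover have "\<bar>y j - p j\<bar> > L - 1"
        using e_less[OF j(1)] N1 tz qL(2) unfolding e_def by linarith
      ultimately show False unfolding L_def by linarith
    qed
    moreover have "y \<noteq> z"
    proof
      assume "y = z"
      then have "y j = z j" by simp
      then have "s \<le> of_int q * L + 1" using e_less[OF j(1)] N1 tz j(2) unfolding e_def by linarith
      then show False using sT qL(1) NL unfolding T_def by linarith
    qed
    ultimately show False by blast
  qed
  note close = this
  have bound: "\<bar>z i\<bar> \<le> T + B" if "z \<in> observers d X" "i < d" for z i
    using close[OF that] B(2)[OF insertI1 that(2)] by linarith
  have "observers d X \<subseteq> {x \<in> int_lattice d. \<forall>i<d. \<bar>x i\<bar> \<le> T + B}"
  proof (rule subsetI, rule CollectI, intro conjI allI impI)
    fix z assume z: "z \<in> observers d X"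
    then show "z \<in> int_lattice d" unfolding observers_def by blast
    show "\<bar>z i\<bar> \<le> T + B" if "i < d" for i by (rule bound[OF z that])
  qed
  then show ?thesis by (rule finite_subset[OF _ finite_lattice_box])
qed

section \<open>Lattice-width and the threshold\<close>

lemma bounded_dotp_hull:
  assumes "finite X"
  shows "bdd_above (dotp d u ` (convex hull X))" "bdd_below (dotp d u ` (convex hull X))"
proof -
  have "dotp d u ` (convex hull X) = convex hull (dotp d u ` X)"
    by (rule convex_hull_linear_image[OF linear_dotp])
  moreover have "bounded (convex hull (dotp d u ` X))"
    using assms by (intro finite_imp_bounded_convex_hull) auto
  ultimately show "bdd_above (dotp d u ` (convex hull X))" "bdd_below (dotp d u ` (convex hull X))"
    by (simp_all add: bounded_imp_bdd_above bounded_imp_bdd_below)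
qed

lemma width_along_mono:
  assumes "S \<noteq> {}" "S \<subseteq> T" "bdd_above (dotp d u ` T)" "bdd_below (dotp d u ` T)"
  shows "width_along d S u \<le> width_along d T u"
proof -
  have "Sup (dotp d u ` S) \<le> Sup (dotp d u ` T)" using assms by (intro cSup_subset_mono) auto
  moreover have "Inf (dotp d u ` T) \<le> Inf (dotp d u ` S)" using assms by (intro cInf_superset_mono) auto
  ultimately show ?thesis by (simp add: width_along_def)
qed

lemma width_along_nonneg:
  assumes "finite X" "X \<noteq> {}"
  shows "0 \<le> width_along d X u"
proof -
  have "Inf (dotp d u ` X) \<le> Sup (dotp d u ` X)"
    using assms by (intro cInf_le_cSup) auto
  then show ?thesis by (simp add: width_along_def)
qed

lemma lattice_width_mono:
  assumes "finite X" "X \<noteq> {}" "X \<subseteq> convex hull Y" "finite Y"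
  shows "lattice_width d X \<le> lattice_width d (convex hull Y)"
proof (cases "int_lattice d - {0} = {}")
  \<comment> \<open>This happens for \<open>d = 0\<close>, where both widths are the infimum of the
    empty set.\<close>
  case True
  then show ?thesis by (simp only: lattice_width_def image_empty)
next
  case False
  have mono: "width_along d X u \<le> width_along d (convex hull Y) u" for u
    by (intro width_along_mono assms bounded_dotp_hull)
  show ?thesis unfolding lattice_width_def
  proof (rule cINF_mono[OF False])
    show "bdd_below (width_along d X ` (int_lattice d - {0}))"
      using width_along_nonneg[OF assms(1,2)] by (intro bdd_belowI2[of _ 0])
  qed (use mono in blast)
qed

text \<open>A threshold exceeded by a real number is finite, so the set whose infimum it is cannot
  be empty, and by well-ordering the infimum belongs to it.\<close>

lemma wider_than_thresholdD:
  assumes "wider_than_threshold d X"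
  obtains w where "X \<noteq> {}" "lattice_width d X > real w"
    "\<And>n. n > 0 \<Longrightarrow> finite (wide_polytopes d n w // unimodular_rel d)"
proof -
  define W where "W = {enat w | w. \<forall>n>0. finite (wide_polytopes d n w // unimodular_rel d)}"
  have *: "X \<noteq> {}" "ereal (lattice_width d X) > ereal_of_enat (Inf W)"
    using assms by (auto simp: wider_than_threshold_def finiteness_threshold_width_def W_def)
  then have "W \<noteq> {}" by (auto simp: Inf_enat_def)
  then have "Inf W \<in> W" by (metis Inf_enat_def LeastI_ex all_not_in_conv)
  then obtain w where "Inf W = enat w" "\<forall>n>0. finite (wide_polytopes d n w // unimodular_rel d)"
    by (auto simp: W_def)
  then show thesis using * by (intro that[of w]) auto
qed

text \<open>A nonzero integral form that is constant on \<open>X\<close> would force the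
  lattice-width down to 0.\<close>

lemma wide_nondegenerate:
  assumes "finite X" "X \<subseteq> int_lattice d" "wider_than_threshold d X"
  shows "nondegenerate d X"
proof -
  obtain w where w: "X \<noteq> {}" "lattice_width d X > real w"
    using wider_than_thresholdD[OF assms(3)] by metis
  show ?thesis
  proof (rule nondegenerate_if_integral[OF assms(1) w(1) assms(2)], rule ccontr)
    fix u c
    assume u: "u \<in> int_lattice d" "\<forall>x\<in>X. dotp d u x = c" "u \<noteq> 0"
    have "dotp d u ` X = {c}" using u(2) w(1) by auto
    then have "width_along d X u = 0" by (simp add: width_along_def)
    moreover have "lattice_width d X \<le> width_along d X u"
      unfolding lattice_width_def using u width_along_nonneg[OF assms(1) w(1)]
      by (intro cINF_lower bdd_belowI2[of _ 0]) auto
    ultimately show False using w(2) by simp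
  qed
qed

section \<open>Full-dimensional polytopes and unimodular maps\<close>

lemma sum_fun_apply: "(\<Sum>i\<in>A. g i) k = (\<Sum>i\<in>A. g i k :: real)"
  by (induction A rule: infinite_finite_induct) auto

text \<open>A point outside the affine hull is detected by a linear functional that vanishes on all
  differences of \<open>Y\<close>, obtained by extending an independent set. On the Euclidean space
  it is a scalar product with its values on the axes, and nondegeneracy makes these values
  zero.\<close>

lemma nondegenerate_full_dimensional:
  assumes "nondegenerate d X" "X \<noteq> {}" "X \<subseteq> Y" "Y \<subseteq> topspace (Euclidean_space d)"
  shows "full_dimensional d (convex hull Y)"
  unfolding full_dimensional_def affine_hull_convex_hull
proof
  have "affine (topspace (Euclidean_space d))"
    by (auto simp: affine_def in_topspace_iff scaleR_fun_def)
  then show "affine hull Y \<subseteq> topspace (Euclidean_space d)" using assms(4) by (simp add: hull_minimal)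
  show "topspace (Euclidean_space d) \<subseteq> affine hull Y"
  proof (rule subsetI, rule ccontr)
    fix t assume t: "t \<in> topspace (Euclidean_space d)" "t \<notin> affine hull Y"
    obtain x0 where x0: "x0 \<in> X" using assms(2) by blast
    define V where "V = (\<lambda>y. y - x0) ` (Y - {x0})"
    have "affine hull Y = (+) x0 ` span V"
      using affine_hull_span2[of x0 Y] subsetD[OF assms(3) x0] by (simp add: V_def)
    moreover have "t = x0 + (t - x0)" by simp
    ultimately have "t - x0 \<notin> span V" using t(2) by blast
    obtain B where B: "B \<subseteq> V" "independent B" "V \<subseteq> span B" using maximal_independent_subset by blast
    have "t - x0 \<notin> span B" using \<open>t - x0 \<notin> span V\<close> B(1) span_mono by blast
    moreover from this have "t - x0 \<notin> B" using span_base by blast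
    ultimately have "independent (insert (t - x0) B)" using B(2) by (simp add: independent_insert)
    then obtain f :: "point \<Rightarrow> real" where f: "linear f" "\<forall>b\<in>insert (t - x0) B. f b = (if b = t - x0 then 1 else 0)"
      using linear_independent_extend[of "insert (t - x0) B" "\<lambda>b. if b = t - x0 then 1 else (0::real)"] by blast
    have fB: "f b = 0" if "b \<in> B" for b
      using bspec[OF f(2), of b] that \<open>t - x0 \<notin> B\<close> by (cases "b = t - x0") simp_all
    have fV: "f (y - x0) = 0" if "y \<in> Y" for y
    proof (cases "y = x0")
      case True
      then show ?thesis using linear_0[OF f(1)] by simp
    next
      case False
      then have "y - x0 \<in> span B" using that B(3) unfolding V_def by blast
      then show ?thesis using fB linear_eq_0_on_span[OF f(1), of B "y - x0"] by blast
    qed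
    define ax :: "nat \<Rightarrow> point" where "ax i = (\<lambda>k. if k = i then 1 else 0)" for i
    define u where "u i = f (ax i)" for i
    have fu: "f x = dotp d u x" if "x \<in> topspace (Euclidean_space d)" for x
    proof -
      have "x = (\<Sum>i<d. x i *\<^sub>R ax i)"
      proof
        fix k
        have "(\<Sum>i<d. x i *\<^sub>R ax i) k = (\<Sum>i<d. if k = i then x i else 0)"
          by (simp add: sum_fun_apply scaleR_fun_def ax_def if_distrib[of "\<lambda>c. _ * c"] cong: if_cong)
        then show "x k = (\<Sum>i<d. x i *\<^sub>R ax i) k" using that by (auto simp: in_topspace_iff)
      qed
      then have "f x = f (\<Sum>i<d. x i *\<^sub>R ax i)" by simp
      also have "\<dots> = dotp d u x"
        by (simp add: linear_sum[OF f(1)] linear_scale[OF f(1)] dotp_def u_def mult.commute)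
      finally show ?thesis .
    qed
    have top: "y - x0 \<in> topspace (Euclidean_space d)" if "y \<in> insert t Y" for y
    proof -
      have "y \<in> topspace (Euclidean_space d)" "x0 \<in> topspace (Euclidean_space d)"
        using that t(1) x0 assms(3,4) by blast+
      then show ?thesis by (simp add: in_topspace_iff)
    qed
    have "dotp d u x = dotp d u x0" if "x \<in> X" for x
    proof -
      have "x \<in> Y" using that assms(3) by blast
      then have "dotp d u (x - x0) = 0" using fV fu[OF top] by simp
      then show ?thesis by (simp add: dotp_diff)
    qed
    then have "u i = 0" if "i < d" for i using nondegenerateD[OF assms(1)] that by blast
    then have "dotp d u (t - x0) = 0" by (simp add: dotp_def)
    then show False using fu[OF top[of t]] f(2) by simp
  qed
qed

text \<open>For lattice points the difference is an integral vector in the kernel of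
  \<open>U\<close>, so the nonzero determinant over the integers can be applied to it
  directly.\<close>

lemma affine_map_inj:
  assumes "U \<in> carrier_mat d d" "Determinant.det U \<in> {1, -1}" "y \<in> int_lattice d" "z \<in> int_lattice d"
    and eq: "affine_map d U t y = affine_map d U t z"
  shows "y = z"
proof -
  define v where "v = Matrix.vec d (\<lambda>j. \<lfloor>y j - z j\<rfloor>)"
  have dim: "dim_vec v = d" by (simp add: v_def)
  have v: "real_of_int (v $ j) = y j - z j" if "j < d" for j
  proof -
    have "y j - z j \<in> \<int>" using assms(3,4) by (auto simp: int_lattice_iff)
    then show ?thesis using that by (auto simp: v_def elim: Ints_cases)
  qed
  have "U *\<^sub>v v = 0\<^sub>v d"
  proof (rule eq_vecI)
    fix i assume "i < dim_vec (0\<^sub>v d)"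
    then have i: "i < d" by simp
    have "real_of_int ((U *\<^sub>v v) $ i) = (\<Sum>j<d. of_int (U $$ (i, j)) * (y j - z j))"
      using i carrier_matD[OF assms(1)] dim v by (simp add: scalar_prod_def atLeast0LessThan cong: sum.cong_simp)
    also have "\<dots> = 0" using fun_cong[OF eq, of i] i
      by (simp add: affine_map_def right_diff_distrib sum_subtractf)
    finally show "(U *\<^sub>v v) $ i = 0\<^sub>v d $ i" using i by simp
  qed (use assms(1) in simp)
  moreover have "Determinant.det U \<noteq> 0" using assms(2) by auto
  ultimately have "v = 0\<^sub>v d"
    using det_0_iff_vec_prod_zero[OF assms(1)] by (metis v_def vec_carrier)
  then have "y j = z j" if "j < d" for j using v[OF that] that by simp
  moreover have "y j = z j" if "j \<ge> d" for j using assms(3,4) that by (auto simp: int_lattice_iff)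
  ultimately show ?thesis by (intro ext) (metis not_le)
qed

text \<open>Each coordinate of the difference of the two maps is an affine function vanishing on
  \<open>X\<close>; its linear part is zero by nondegeneracy, and then so is its constant.\<close>

lemma affine_map_eq_on:
  assumes "nondegenerate d X" "X \<noteq> {}" "\<And>x. x \<in> X \<Longrightarrow> affine_map d U t x = affine_map d V s x"
  shows "affine_map d U t y = affine_map d V s y"
proof
  fix i
  define c where "c j = real_of_int (U $$ (i, j)) - of_int (V $$ (i, j))" for j
  show "affine_map d U t y i = affine_map d V s y i"
  proof (cases "i < d")
    case True
    have *: "affine_map d U t x i - affine_map d V s x i = dotp d c x + (t i - s i)" for x
      using True by (simp add: affine_map_def dotp_def c_def left_diff_distrib sum_subtractf)
    have "dotp d c x = s i - t i" if "x \<in> X" for x using *[of x] assms(3)[OF that] by simp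
    moreover from this have "c j = 0" if "j < d" for j using nondegenerateD[OF assms(1)] that by blast
    moreover obtain x where "x \<in> X" using assms(2) by blast
    ultimately have "dotp d c y = 0" "s i - t i = 0" by (auto simp: dotp_def)
    then show ?thesis using *[of y] by simp
  qed (simp add: affine_map_def)
qed

text \<open>Otherwise infinitely many of the polytopes \<open>conv (X \<union> {z})\<close> would be equivalent. By the pigeonhole
  principle two of the equivalences to a fixed one agree on \<open>X\<close>, hence everywhere, and map two different
  observers to the same point.\<close>

lemma wide_finite_observers:
  assumes "finite X" "X \<subseteq> int_lattice d" "wider_than_threshold d X"
  shows "finite (observers d X)"
proof (rule ccontr)
  assume inf: "infinite (observers d X)"
  obtain w where X: "X \<noteq> {}" and w: "lattice_width d X > real w"
    "\<And>n. n > 0 \<Longrightarrow> finite (wide_polytopes d n w // unimodular_rel d)"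
    using wider_than_thresholdD[OF assms(3)] by metis
  note nd = wide_nondegenerate[OF assms]
  define P where "P z = convex hull (insert z X)" for z
  have obs: "z \<in> int_lattice d" "z \<notin> X" "P z \<inter> int_lattice d = insert z X" if "z \<in> observers d X" for z
    using that by (auto simp: observers_def P_def)
  \<comment> \<open>An observer adds exactly one lattice point, so all these polytopes share the
    same \<open>n\<close>, and enlarging \<open>X\<close> cannot decrease the width.\<close>
  have "P z \<in> wide_polytopes d (Suc (card X)) w" if "z \<in> observers d X" for z
    unfolding wide_polytopes_def
  proof (intro CollectI conjI)
    have sub: "insert z X \<subseteq> int_lattice d" using obs[OF that] assms(2) by simp
    then show "lattice_polytope d (P z)" unfolding lattice_polytope_def P_def using assms(1) by blast
    show "full_dimensional d (P z)" unfolding P_def using sub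
      by (intro nondegenerate_full_dimensional[OF nd X]) (auto simp: int_lattice_def)
    show "card (P z \<inter> int_lattice d) = Suc (card X)" using obs[OF that] assms(1) by simp
    have "lattice_width d X \<le> lattice_width d (P z)"
      unfolding P_def using assms(1) X by (intro lattice_width_mono) (auto simp: hull_inc)
    then show "real w < lattice_width d (P z)" using w(1) by simp
  qed
  then have "(\<lambda>z. unimodular_rel d `` {P z}) ` observers d X \<subseteq> wide_polytopes d (Suc (card X)) w // unimodular_rel d"
    by (auto simp: quotient_def)
  then have "finite ((\<lambda>z. unimodular_rel d `` {P z}) ` observers d X)"
    using w(2) finite_subset by blast
  then obtain z0 where z0: "z0 \<in> observers d X"
    "infinite {z \<in> observers d X. unimodular_rel d `` {P z} = unimodular_rel d `` {P z0}}"
    using pigeonhole_infinite[OF inf] by blast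
  define Z where "Z = {z \<in> observers d X. unimodular_rel d `` {P z} = unimodular_rel d `` {P z0}}"
  \<comment> \<open>As \<open>P z0\<close> lies in its own class, equality of the classes of
    \<open>P z\<close> and \<open>P z0\<close> yields an actual map of \<open>P z\<close> onto
    \<open>P z0\<close>.\<close>
  have refl: "(P z0, P z0) \<in> unimodular_rel d"
  proof -
    have "insert z0 X \<subseteq> topspace (Euclidean_space d)"
      using obs(1)[OF z0(1)] assms(2) by (auto simp: int_lattice_def)
    then have top: "P z0 \<subseteq> topspace (Euclidean_space d)"
      unfolding P_def by (rule hull_subset_topspace)
    have id: "affine_map d (1\<^sub>m d) 0 x = x" if "x \<in> P z0" for x
    proof
      fix i
      show "affine_map d (1\<^sub>m d) 0 x i = x i"
      proof (cases "i < d")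
        case True
        have "(\<Sum>j<d. of_int ((1\<^sub>m d :: int mat) $$ (i, j)) * x j) = (\<Sum>j<d. if i = j then x j else 0)"
          using True by (intro sum.cong) auto
        then show ?thesis using True by (simp add: affine_map_def)
      next
        case False
        moreover have "x \<in> topspace (Euclidean_space d)" using that top by blast
        ultimately show ?thesis by (simp add: affine_map_def in_topspace_iff)
      qed
    qed
    have "P z0 = affine_map d (1\<^sub>m d) 0 ` P z0" using id by force
    moreover have "(0 :: point) \<in> int_lattice d" by (simp add: int_lattice_iff)
    ultimately show ?thesis unfolding unimodular_rel_def
      by (auto intro!: exI[of _ "1\<^sub>m d"] exI[of _ 0])
  qed
  have "\<exists>U t. U \<in> carrier_mat d d \<and> Determinant.det U \<in> {1, -1} \<and> t \<in> int_lattice d \<and> P z0 = affine_map d U t ` P z"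
    if "z \<in> Z" for z
  proof -
    have "(P z, P z0) \<in> unimodular_rel d" using that refl by (auto simp: Z_def)
    then show ?thesis by (auto simp: unimodular_rel_def)
  qed
  then obtain U t where Ut: "\<And>z. z \<in> Z \<Longrightarrow> U z \<in> carrier_mat d d" "\<And>z. z \<in> Z \<Longrightarrow> Determinant.det (U z) \<in> {1, -1}"
    "\<And>z. z \<in> Z \<Longrightarrow> t z \<in> int_lattice d" "\<And>z. z \<in> Z \<Longrightarrow> P z0 = affine_map d (U z) (t z) ` P z"
    by metis
  have affine_int: "affine_map d (U z) (t z) x \<in> int_lattice d" if "z \<in> Z" "x \<in> int_lattice d" for z x
    using that Ut(3)[OF that(1)]
    by (auto simp: affine_map_def int_lattice_iff intro!: Ints_add Ints_sum Ints_mult)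
  have mem: "affine_map d (U z) (t z) x \<in> insert z0 X" if "z \<in> Z" "x \<in> insert z X" for z x
  proof -
    have "x \<in> int_lattice d" "x \<in> P z"
      using that obs[of z] assms(2) by (auto simp: Z_def P_def hull_inc)
    then have "affine_map d (U z) (t z) x \<in> P z0 \<inter> int_lattice d"
      using Ut(4)[OF that(1)] affine_int[OF that(1)] by blast
    then show ?thesis using obs(3)[OF z0(1)] by simp
  qed
  \<comment> \<open>Records where the equivalence sends \<open>X\<close> and \<open>z\<close>.
    Lattice points of \<open>P z\<close> go to lattice points of \<open>P z0\<close>, which leaves
    finitely many possible records.\<close>
  define g where "g z = (restrict (affine_map d (U z) (t z)) X, affine_map d (U z) (t z) z)" for z
  have "g ` Z \<subseteq> (X \<rightarrow>\<^sub>E insert z0 X) \<times> insert z0 X"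
  proof (rule image_subsetI)
    fix z assume z: "z \<in> Z"
    have "restrict (affine_map d (U z) (t z)) X \<in> X \<rightarrow>\<^sub>E insert z0 X"
      by (rule PiE_I) (use mem[OF z] in \<open>simp_all only: restrict_apply' insertI2, simp add: restrict_def\<close>)
    then show "g z \<in> (X \<rightarrow>\<^sub>E insert z0 X) \<times> insert z0 X"
      using mem[OF z] by (simp only: g_def mem_Sigma_iff insertI1 simp_thms)
  qed
  moreover have "finite ((X \<rightarrow>\<^sub>E insert z0 X) \<times> insert z0 X)" using assms(1) by (simp add: finite_PiE)
  ultimately have "finite (g ` Z)" by (rule finite_subset)
  then have "\<not> inj_on g Z" using z0(2) finite_imageD unfolding Z_def by blast
  then obtain y z where yz: "y \<in> Z" "z \<in> Z" "y \<noteq> z" "g y = g z" by (auto simp: inj_on_def)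
  have eq: "affine_map d (U y) (t y) x = affine_map d (U z) (t z) x" if "x \<in> X" for x
    using yz(4) that unfolding g_def by (metis (no_types, lifting) fst_conv restrict_apply')
  have "affine_map d (U y) (t y) z = affine_map d (U z) (t z) z"
    by (rule affine_map_eq_on[OF nd X]) (rule eq)
  then have "affine_map d (U y) (t y) y = affine_map d (U y) (t y) z"
    using yz(4) by (simp add: g_def)
  moreover have "y \<in> int_lattice d" "z \<in> int_lattice d" using yz(1,2) obs(1) unfolding Z_def by blast+
  ultimately have "y = z" using affine_map_inj[OF Ut(1,2)[OF yz(1)]] by blast
  then show False using yz(3) by simp
qed

subsection \<open>Relaxation complexity as a colouring number\<close>

definition separable :: "nat \<Rightarrow> point set \<Rightarrow> point set \<Rightarrow> bool"
  where "separable d X Y \<longleftrightarrow> (\<exists>a\<in>int_lattice d. \<forall>x\<in>X. \<forall>y\<in>Y. dotp d a x < dotp d a y)"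

text \<open>\<open>separation_colorable d k X Y\<close> says that \<open>k\<close> closed halfspaces containing \<open>X\<close> suffice to
  cut off all points of \<open>Y\<close>; the colour of \<open>y\<close> is a halfspace that does not contain it.\<close>

definition separation_colorable :: "nat \<Rightarrow> nat \<Rightarrow> point set \<Rightarrow> point set \<Rightarrow> bool"
  where "separation_colorable d k X Y \<longleftrightarrow>
    (\<exists>c :: point \<Rightarrow> nat. (\<forall>y\<in>Y. c y < k) \<and> (\<forall>j<k. separable d X {y\<in>Y. c y = j}))"

lemma separation_colorable_mono:
  assumes "separation_colorable d k X Y" "k \<le> l"
  shows "separation_colorable d l X Y"
proof -
  obtain c where c: "\<And>y. y \<in> Y \<Longrightarrow> c y < k" "\<And>j. j < k \<Longrightarrow> separable d X {y\<in>Y. c y = j}"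
    using assms(1) by (auto simp: separation_colorable_def)
  have "separable d X {y\<in>Y. c y = j}" for j
  proof (cases "j < k")
    case False
    then have "{y\<in>Y. c y = j} = {}" using c(1) by fastforce
    moreover have "(0 :: point) \<in> int_lattice d" by (simp add: int_lattice_iff)
    ultimately show ?thesis unfolding separable_def by blast
  qed (use c in blast)
  moreover have "c y < l" if "y \<in> Y" for y using c(1)[OF that] assms(2) by simp
  ultimately show ?thesis unfolding separation_colorable_def by blast
qed

lemma described_by_mono:
  assumes "described_by K d k X" "K \<subseteq> L"
  shows "described_by L d k X"
proof -
  obtain m :: nat and A b U v where *: "\<forall>i<k. b i \<in> K \<and> (\<forall>j<d. A i j \<in> K)" "\<forall>i<m. v i \<in> K \<and> (\<forall>j<d. U i j \<in> K)"
    "X = {x \<in> int_lattice d. (\<forall>i<k. dotp d (A i) x \<le> b i) \<and> (\<forall>i<m. dotp d (U i) x = v i)}"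
    using assms(1) unfolding described_by_def by blast
  have "\<forall>i<k. b i \<in> L \<and> (\<forall>j<d. A i j \<in> L)" "\<forall>i<m. v i \<in> L \<and> (\<forall>j<d. U i j \<in> L)"
    using *(1,2) assms(2) by blast+
  with *(3) show ?thesis unfolding described_by_def
    by (intro exI[of _ m] exI[of _ A] exI[of _ b] exI[of _ U] exI[of _ v] conjI)
qed

lemma dotp_sum_list: "dotp d a (sum_list L) = (\<Sum>x\<leftarrow>L. dotp d a x)"
  by (induction L) (simp_all only: list.map sum_list.Nil sum_list.Cons dotp_zero dotp_add)

lemma sum_list_pos:
  fixes f :: "'a \<Rightarrow> real"
  assumes "L \<noteq> []" "\<And>x. x \<in> set L \<Longrightarrow> f x > 0"
  shows "(\<Sum>x\<leftarrow>L. f x) > 0"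
  using assms by (induction L rule: list_nonempty_induct) (auto intro: add_pos_pos)

lemma zero_sum_not_separated:
  assumes "L \<noteq> []" "set L \<subseteq> X \<times> Y" "(\<Sum>(x, y)\<leftarrow>L. y - x) = 0"
    and sep: "\<And>x y. x \<in> X \<Longrightarrow> y \<in> Y \<Longrightarrow> dotp d a x < dotp d a y"
  shows False
proof -
  have "(\<Sum>l\<leftarrow>L. dotp d a (snd l - fst l)) > 0"
    using assms(1,2) sep by (intro sum_list_pos) (auto simp: dotp_diff)
  also have "(\<Sum>l\<leftarrow>L. dotp d a (snd l - fst l)) = dotp d a (\<Sum>(x, y)\<leftarrow>L. y - x)"
    by (simp add: dotp_sum_list comp_def case_prod_unfold)
  finally show False using assms(3) by simp
qed

text \<open>A real normal vector already rules out a vanishing sum of differences, and the other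
  alternative is an integral vector. This is where real coefficients lose their advantage over
  rational ones.\<close>

lemma separable_if_real:
  assumes "finite X" "finite Y" "X \<subseteq> int_lattice d" "Y \<subseteq> int_lattice d"
    and "\<And>x y. x \<in> X \<Longrightarrow> y \<in> Y \<Longrightarrow> dotp d a x < dotp d a y"
  shows "separable d X Y"
  using integral_separation[OF assms(1-4)] zero_sum_not_separated[OF _ _ _ assms(5)]
  unfolding separable_def by blast

text \<open>An equation valid on a nondegenerate set is valid everywhere. So each point outside
  \<open>X\<close> violates an inequality, and the index of one such inequality serves as its
  colour.\<close>

lemma described_imp_colorable:
  assumes "described_by UNIV d k X" "nondegenerate d X" "finite X" "X \<noteq> {}"
    and "finite Y" "Y \<subseteq> int_lattice d - X"
  shows "separation_colorable d k X Y"
proof -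
  obtain m :: nat and A b U v where
    X: "X = {x \<in> int_lattice d. (\<forall>i<k. dotp d (A i) x \<le> b i) \<and> (\<forall>i<m. dotp d (U i) x = v i)}"
    using assms(1) unfolding described_by_def by blast
  have eq: "dotp d (U i) x = v i" if "i < m" for i x
  proof -
    have "dotp d (U i) x = v i" if "x \<in> X" for x using that \<open>i < m\<close> unfolding X by blast
    moreover from this have "U i j = 0" if "j < d" for j using nondegenerateD[OF assms(2)] that by blast
    then have "dotp d (U i) x = 0" for x by (simp add: dotp_def)
    ultimately show ?thesis using assms(4) by (metis all_not_in_conv)
  qed
  have "\<exists>i<k. b i < dotp d (A i) y" if "y \<in> Y" for y
    using that assms(6) X eq by (force simp: not_le[symmetric])
  then obtain c where c: "\<And>y. y \<in> Y \<Longrightarrow> c y < k" "\<And>y. y \<in> Y \<Longrightarrow> b (c y) < dotp d (A (c y)) y"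
    by metis
  have "separable d X {y\<in>Y. c y = j}" if "j < k" for j
  proof (rule separable_if_real[where a = "A j"])
    show "dotp d (A j) x < dotp d (A j) y" if "x \<in> X" "y \<in> {y\<in>Y. c y = j}" for x y
    proof -
      have "dotp d (A j) x \<le> b j" using that(1) \<open>j < k\<close> unfolding X by blast
      also have "b j < dotp d (A j) y" using c(2)[of y] that(2) by auto
      finally show ?thesis .
    qed
  qed (use assms X in auto)
  then show ?thesis unfolding separation_colorable_def using c(1) by blast
qed

text \<open>The most restrictive kind of description, integral and without equations. Colourings
  turn even an arbitrary real description into one of this kind.\<close>

definition integrally_described :: "nat \<Rightarrow> nat \<Rightarrow> point set \<Rightarrow> bool"
  where "integrally_described d k X \<longleftrightarrow> (\<exists>A b. (\<forall>i<k. A i \<in> int_lattice d \<and> b i \<in> \<int>) \<and>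
    X = {x \<in> int_lattice d. \<forall>i<k. dotp d (A i) x \<le> b i})"

text \<open>A relaxation that cuts off all observers is exact: a further lattice point in it would produce an
  observer in it.\<close>

lemma colorable_imp_integrally_described:
  assumes "separation_colorable d k X Y" "finite X" "X \<noteq> {}" "lattice_convex d X"
    and "observers d X \<subseteq> Y"
  shows "integrally_described d k X"
proof -
  have Xl: "X \<subseteq> int_lattice d" using assms(4) by (auto simp: lattice_convex_def)
  obtain c where c: "\<And>y. y \<in> Y \<Longrightarrow> c y < k" "\<And>j. j < k \<Longrightarrow> separable d X {y\<in>Y. c y = j}"
    using assms(1) by (auto simp: separation_colorable_def)
  then obtain A where A: "\<And>j. j < k \<Longrightarrow> A j \<in> int_lattice d"
    "\<And>j x y. j < k \<Longrightarrow> x \<in> X \<Longrightarrow> y \<in> Y \<Longrightarrow> c y = j \<Longrightarrow> dotp d (A j) x < dotp d (A j) y"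
    unfolding separable_def by (metis (mono_tags, lifting) mem_Collect_eq)
  \<comment> \<open>The tightest right-hand side. It is attained on \<open>X\<close>, hence is an
    integer and lies strictly below the values at the points of colour \<open>j\<close>.\<close>
  define b where "b j = Max (dotp d (A j) ` X)" for j
  have bX: "dotp d (A j) x \<le> b j" if "x \<in> X" for j x
    unfolding b_def using assms(2) that by (intro Max_ge) auto
  have b_in: "b j \<in> dotp d (A j) ` X" for j unfolding b_def using assms(2,3) by (intro Max_in) auto
  have "X = {x \<in> int_lattice d. \<forall>i<k. dotp d (A i) x \<le> b i}" (is "X = ?P")
  proof (intro equalityI subsetI)
    fix z assume z: "z \<in> ?P"
    show "z \<in> X"
    proof (rule ccontr)
      assume "z \<notin> X"
      then obtain y where y: "y \<in> observers d X" "y \<in> convex hull (insert z X)"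
        using exists_observer[OF assms(2,3,4)] z by blast
      define j where "j = c y"
      have j: "y \<in> Y" "j < k" using y(1) assms(5) c(1) by (auto simp: j_def)
      have "convex hull (insert z X) \<subseteq> {x. dotp d (A j) x \<le> b j}"
        using z bX j(2) by (intro hull_minimal convex_dotp_le) auto
      then have "dotp d (A j) y \<le> b j" using y(2) by blast
      moreover obtain x where "x \<in> X" "b j = dotp d (A j) x" using b_in[of j] by blast
      ultimately show False using A(2)[OF j(2) _ j(1), of x] by (simp add: j_def)
    qed
  qed (use bX Xl in blast)
  moreover have "b j \<in> \<int>" if "j < k" for j
  proof -
    obtain x where "x \<in> X" "b j = dotp d (A j) x" using b_in[of j] by blast
    then show ?thesis using dotp_Ints[OF A(1)[OF that], of x] Xl by auto
  qed
  ultimately show ?thesis unfolding integrally_described_def using A(1) by blast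
qed

lemma integrally_described_imp_described:
  assumes "integrally_described d k X"
  shows "described_by \<rat> d k X"
proof -
  obtain A b where Ab: "\<forall>i<k. A i \<in> int_lattice d \<and> b i \<in> \<int>"
    "X = {x \<in> int_lattice d. \<forall>i<k. dotp d (A i) x \<le> b i}"
    using assms unfolding integrally_described_def by blast
  then have "\<forall>i<k. b i \<in> \<rat> \<and> (\<forall>j<d. A i j \<in> \<rat>)"
    by (meson int_latticeD(1) Ints_subset_Rats subsetD)
  then show ?thesis unfolding described_by_def using Ab(2)
    by (intro exI[of _ 0] exI[of _ A] exI[of _ b]) auto
qed

text \<open>Each observer receives a colour of its own, since a single lattice point outside the
  hull can always be separated.\<close>

lemma observers_colorable:
  assumes "finite X" "lattice_convex d X" "finite (observers d X)"
  shows "\<exists>k. separation_colorable d k X (observers d X)"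
proof -
  have Xl: "X \<subseteq> int_lattice d" using assms(2) by (auto simp: lattice_convex_def)
  obtain c where c: "bij_betw c (observers d X) {0..<card (observers d X)}"
    using ex_bij_betw_finite_nat[OF assms(3)] by blast
  have "separable d X {y\<in>observers d X. c y = j}" if j: "j < card (observers d X)" for j
  proof -
    have "j \<in> c ` observers d X" using c j by (simp add: bij_betw_def)
    then obtain z where z: "z \<in> observers d X" "c z = j" by blast
    then have single: "{y\<in>observers d X. c y = j} = {z}" using c by (auto simp: bij_betw_def inj_on_def)
    have "z \<in> int_lattice d" "z \<notin> convex hull X"
      using z(1) assms(2) unfolding observers_def lattice_convex_def by blast+
    then show ?thesis unfolding single separable_def using separation_from_hull[OF assms(1) Xl] by blast
  qed
  moreover have "c y < card (observers d X)" if "y \<in> observers d X" for y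
    using c that by (auto simp: bij_betw_def)
  ultimately show ?thesis unfolding separation_colorable_def by blast
qed

section \<open>Dickson's lemma and recession directions\<close>

lemma nat_sequence_incseq_subseq:
  fixes t :: "nat \<Rightarrow> nat"
  shows "\<exists>r :: nat \<Rightarrow> nat. strict_mono r \<and> (\<forall>m n. m \<le> n \<longrightarrow> t (r m) \<le> t (r n))"
proof -
  obtain r :: "nat \<Rightarrow> nat" where r: "strict_mono r" "monoseq (\<lambda>n. t (r n))" using seq_monosub by blast
  show ?thesis
  proof (cases "\<forall>m n. m \<le> n \<longrightarrow> t (r m) \<le> t (r n)")
    case False
    then have dec: "\<And>m n. m \<le> n \<Longrightarrow> t (r n) \<le> t (r m)" using r(2) unfolding monoseq_def by blast
    obtain N where N: "\<And>n. t (r N) \<le> t (r n)"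
      using ex_has_least_nat[of "\<lambda>_. True" 0 "\<lambda>n. t (r n)"] by blast
    have const: "t (r (N + n)) = t (r N)" for n using N[of "N + n"] dec[of N "N + n"] by simp
    have "strict_mono (\<lambda>n. r (N + n))" using r(1) by (simp add: strict_mono_def)
    then have "strict_mono (\<lambda>n. r (N + n)) \<and> (\<forall>m n. m \<le> n \<longrightarrow> t (r (N + m)) \<le> t (r (N + n)))"
      by (simp add: const)
    then show ?thesis by (rule exI[of _ "\<lambda>n. r (N + n)"])
  qed (use r in blast)
qed

text \<open>Subtracting an integral form from its integral upper bound gives natural numbers, and
  any sequence of these has a nondecreasing subsequence. Refining once for each \<open>j\<close>
  treats finitely many forms.\<close>

lemma dickson:
  fixes f :: "'j \<Rightarrow> 'a \<Rightarrow> real"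
  assumes "finite J" "infinite G" "\<And>j g. j \<in> J \<Longrightarrow> g \<in> G \<Longrightarrow> f j g \<in> \<int> \<and> f j g \<le> of_int (c j)"
  shows "\<exists>s :: nat \<Rightarrow> 'a. inj s \<and> range s \<subseteq> G \<and> (\<forall>j\<in>J. \<forall>m n. m \<le> n \<longrightarrow> f j (s n) \<le> f j (s m))"
  using assms(1,3)
proof (induction J)
  case empty
  then show ?case using infinite_countable_subset[OF assms(2)] by blast
next
  case (insert j J)
  then obtain s :: "nat \<Rightarrow> 'a" where s: "inj s" "range s \<subseteq> G"
    "\<And>i m n. i \<in> J \<Longrightarrow> m \<le> n \<Longrightarrow> f i (s n) \<le> f i (s m)" by auto
  define t where "t n = nat \<lfloor>of_int (c j) - f j (s n)\<rfloor>" for n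
  have t: "f j (s n) = of_int (c j) - real (t n)" for n
  proof -
    have "f j (s n) \<in> \<int>" "f j (s n) \<le> of_int (c j)" using insert.prems[of j "s n"] s(2) by auto
    then show ?thesis by (auto simp: t_def elim!: Ints_cases simp flip: of_int_diff)
  qed
  obtain r :: "nat \<Rightarrow> nat" where r: "strict_mono r" "\<And>m n. m \<le> n \<Longrightarrow> t (r m) \<le> t (r n)"
    using nat_sequence_incseq_subseq[of t] by blast
  have "f i (s (r n)) \<le> f i (s (r m))" if "i \<in> insert j J" "m \<le> n" for i m n
  proof (cases "i = j")
    case True
    then show ?thesis using r(2)[OF that(2)] by (simp add: t)
  next
    case False
    then show ?thesis using that s(3) strict_mono_leD[OF r(1) that(2)] by blast
  qed
  moreover have "inj (\<lambda>n. s (r n))" 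
    by (rule injI) (simp add: inj_eq[OF s(1)] strict_mono_eq[OF r(1)])
  ultimately show ?case using s(2) by (intro exI[of _ "\<lambda>n. s (r n)"]) auto
qed

text \<open>If there are infinitely many lattice points in the shifted polyhedron, then by Dickson's lemma the
  difference of two of them is a recession direction.\<close>

lemma finite_shifted_polyhedron:
  assumes J: "finite J" "\<And>j. j \<in> J \<Longrightarrow> a j \<in> int_lattice d"
    and fin: "finite {x \<in> int_lattice d. \<forall>j\<in>J. dotp d (a j) x \<le> b j}"
    and ne: "{x \<in> int_lattice d. \<forall>j\<in>J. dotp d (a j) x \<le> b j} \<noteq> {}"
  shows "finite {x \<in> int_lattice d. \<forall>j\<in>J. dotp d (a j) x \<le> of_int (c j)}" (is "finite ?Q")
proof (rule ccontr)
  let ?P = "{x \<in> int_lattice d. \<forall>j\<in>J. dotp d (a j) x \<le> b j}"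
  assume inf: "infinite ?Q"
  have bnd: "dotp d (a j) x \<in> \<int> \<and> dotp d (a j) x \<le> of_int (c j)" if "j \<in> J" "x \<in> ?Q" for j x
    using dotp_Ints[OF J(2)[OF that(1)], of x] that by simp
  from dickson[where f = "\<lambda>j. dotp d (a j)", OF J(1) inf bnd]
  obtain s :: "nat \<Rightarrow> point" where "inj s \<and> range s \<subseteq> ?Q \<and>
    (\<forall>j\<in>J. \<forall>m n. m \<le> n \<longrightarrow> dotp d (a j) (s n) \<le> dotp d (a j) (s m))"
    by (rule exE)
  then have s: "inj s" "range s \<subseteq> ?Q"
    "\<forall>j\<in>J. \<forall>m n. m \<le> n \<longrightarrow> dotp d (a j) (s n) \<le> dotp d (a j) (s m)"
    by simp_all
  define w where "w = s 1 - s 0"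
  have "s 1 \<noteq> s 0" by (simp add: inj_eq[OF s(1)])
  then obtain i where i: "s 1 i \<noteq> s 0 i" by (auto simp: fun_eq_iff)
  have w: "w \<in> int_lattice d" "w i \<noteq> 0" "\<And>j. j \<in> J \<Longrightarrow> dotp d (a j) w \<le> 0"
  proof -
    have "s 0 \<in> int_lattice d" "s 1 \<in> int_lattice d" using s(2) by blast+
    then show "w \<in> int_lattice d" unfolding w_def by (intro int_lattice_closed)
    show "w i \<noteq> 0" using i by (simp add: w_def)
    show "dotp d (a j) w \<le> 0" if "j \<in> J" for j
    proof -
      have "dotp d (a j) (s 1) \<le> dotp d (a j) (s 0)" using s(3) that zero_le_one by blast
      then show ?thesis by (simp add: w_def dotp_diff)
    qed
  qed
  \<comment> \<open>The direction \<open>w\<close> does not depend on the right-hand sides, so it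
    generates a ray of lattice points in the original polyhedron as well.\<close>
  obtain x where x: "x \<in> ?P" using ne by blast
  have "x + real n *\<^sub>R w \<in> ?P" for n
  proof -
    have "dotp d (a j) (x + real n *\<^sub>R w) \<le> b j" if "j \<in> J" for j
    proof -
      have "real n * dotp d (a j) w \<le> 0" using w(3)[OF that] by (simp add: mult_nonneg_nonpos)
      moreover have "dotp d (a j) x \<le> b j" using x that by blast
      ultimately show ?thesis by (simp only: dotp_add dotp_scaleR)
    qed
    moreover have "x + real n *\<^sub>R w \<in> int_lattice d"
      using x w(1) by (auto simp: int_lattice_iff scaleR_fun_def)
    ultimately show ?thesis by blast
  qed
  moreover have "inj (\<lambda>n. x + real n *\<^sub>R w)"
  proof (rule injI)
    fix m n assume "x + real m *\<^sub>R w = x + real n *\<^sub>R w"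
    then have "real m *\<^sub>R w = real n *\<^sub>R w" by (rule add_left_imp_eq)
    moreover have "w \<noteq> 0" using w(2) by auto
    ultimately show "m = n" by simp
  qed
  ultimately have "infinite ?P"
    using finite_subset[of "range (\<lambda>n. x + real n *\<^sub>R w)" ?P] finite_imageD[of _ UNIV] by blast
  then show False using fin by simp
qed

subsection \<open>Certificates\<close>

definition iprod :: "int list \<Rightarrow> int list \<Rightarrow> int"
  where "iprod a p = (\<Sum>z\<leftarrow>zip a p. fst z * snd z)"

definition norm1 :: "int list \<Rightarrow> int"
  where "norm1 a = (\<Sum>t\<leftarrow>a. \<bar>t\<bar>)"

definition lattice_box :: "nat \<Rightarrow> nat \<Rightarrow> int list list"
  where "lattice_box d M = product_lists (replicate d (map (\<lambda>i. int i - int M) [0..<2 * M + 1]))"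

lemma set_lattice_box: "set (lattice_box d M) = {p. length p = d \<and> (\<forall>t\<in>set p. \<bar>t\<bar> \<le> int M)}"
proof -
  define R where "R = map (\<lambda>i. int i - int M) [0..<2 * M + 1]"
  have R: "set R = {t. \<bar>t\<bar> \<le> int M}"
    unfolding R_def
  proof (intro equalityI subsetI)
    fix t assume "t \<in> {t. \<bar>t\<bar> \<le> int M}"
    then have "t = int (nat (t + int M)) - int M" "nat (t + int M) < 2 * M + 1" by auto
    then show "t \<in> set (map (\<lambda>i. int i - int M) [0..<2 * M + 1])"
      unfolding set_map set_upt by (intro image_eqI[of _ _ "nat (t + int M)"]) auto
  qed auto
  have "lattice_box d M = product_lists (replicate d R)" by (simp add: lattice_box_def R_def)
  then show ?thesis
    by (auto simp: product_lists_set list_all2_conv_all_nth all_set_conv_all_nth R)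
qed

lemma point_of_nth: "length p = d \<Longrightarrow> i < d \<Longrightarrow> point_of p i = of_int (p ! i)"
  by (simp add: point_of_def)

lemma point_of_in_int_lattice: "length p = d \<Longrightarrow> point_of p \<in> int_lattice d"
  by (auto simp: point_of_def int_lattice_iff)

lemma point_of_eq_iff: "length p = length q \<Longrightarrow> point_of p = point_of q \<longleftrightarrow> p = q"
  by (auto simp: point_of_def fun_eq_iff list_eq_iff_nth_eq split: if_splits)

lemma int_lattice_point_of:
  assumes "x \<in> int_lattice d"
  shows "\<exists>p. length p = d \<and> x = point_of p"
proof (intro exI conjI)
  have "x i = of_int \<lfloor>x i\<rfloor>" for i using int_latticeD(1)[OF assms, of i] by (auto elim: Ints_cases)
  moreover have "x i = 0" if "i \<ge> d" for i using int_latticeD(2)[OF assms that] .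
  ultimately show "x = point_of (map (\<lambda>i. \<lfloor>x i\<rfloor>) [0..<d])"
    by (auto simp: point_of_def fun_eq_iff)
qed simp

lemma dotp_point_of:
  assumes "length p = d"
  shows "dotp d (point_of a) (point_of p) = of_int (iprod a p)"
proof -
  have "of_int (iprod a p) = (\<Sum>i<min (length a) d. real_of_int (a ! i * p ! i))"
    using assms by (simp add: iprod_def sum_list_sum_nth atLeast0LessThan)
  also have "\<dots> = (\<Sum>i<d. point_of a i * point_of p i)"
    using assms by (intro sum.mono_neutral_cong_left) (auto simp: point_of_def)
  finally show ?thesis by (simp add: dotp_def)
qed

lemma sum_abs_point_of_le: "(\<Sum>i<d. \<bar>point_of a i\<bar>) \<le> of_int (norm1 a)"
proof -
  have "(\<Sum>i<d. \<bar>point_of a i\<bar>) = (\<Sum>i<min (length a) d. real_of_int \<bar>a ! i\<bar>)"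
    by (intro sum.mono_neutral_cong_right) (auto simp: point_of_def)
  also have "\<dots> \<le> (\<Sum>i<length a. real_of_int \<bar>a ! i\<bar>)" by (intro sum_mono2) auto
  also have "\<dots> = of_int (norm1 a)" by (simp add: norm1_def sum_list_sum_nth atLeast0LessThan)
  finally show ?thesis .
qed

definition satisfies :: "(int list \<times> int) list \<Rightarrow> int list \<Rightarrow> bool"
  where "satisfies A p \<longleftrightarrow> (\<forall>c\<in>set A. iprod (fst c) p \<le> snd c)"

text \<open>The last condition makes sure that the polyhedron described by \<open>A\<close> does not meet the boundary of the
  box: rounding a boundary point changes the left-hand side of an inequality by at most \<^const>\<open>norm1\<close>.\<close>

definition description_cert :: "nat \<Rightarrow> int list list \<Rightarrow> nat \<Rightarrow> (int list \<times> int) list \<Rightarrow> bool"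
  where "description_cert d ps M A \<longleftrightarrow>
    (\<forall>p\<in>set ps. p \<in> set (lattice_box d M) \<and> satisfies A p) \<and>
    (\<forall>g\<in>set (lattice_box d M). g \<in> set ps \<or> \<not> satisfies A g) \<and>
    (\<forall>g\<in>set (lattice_box d M). (\<forall>t\<in>set g. \<bar>t\<bar> < int M) \<or>
      (\<exists>c\<in>set A. snd c + norm1 (fst c) < iprod (fst c) g))"

text \<open>\<open>h i\<close> is the parameter at which coordinate \<open>i\<close> reaches
  \<open>R\<close> on the side of \<open>z i\<close>, where the factor \<open>sgn (z i)\<close>
  reduces to the positive side. The smallest of these parameters marks the first exit from the
  box.\<close>

lemma segment_meets_box_boundary:
  fixes x z :: point
  assumes x: "\<And>i. i < d \<Longrightarrow> \<bar>x i\<bar> \<le> R" and z: "\<exists>i<d. \<bar>z i\<bar> > R"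
  obtains t j where "0 \<le> t" "t \<le> 1" "\<And>i. i < d \<Longrightarrow> \<bar>(1 - t) * x i + t * z i\<bar> \<le> R"
    "j < d" "\<bar>(1 - t) * x j + t * z j\<bar> = R"
proof -
  define I where "I = {i\<in>{..<d}. \<bar>z i\<bar> > R}"
  define u where "u i = sgn (z i) * x i" for i
  define h where "h i = (R - u i) / (\<bar>z i\<bar> - u i)" for i
  define t where "t = Min (h ` I)"
  have I: "finite I" "I \<noteq> {}" using z by (auto simp: I_def)
  have u: "- R \<le> u i" "u i \<le> R" "\<bar>z i\<bar> > R" if "i \<in> I" for i
  proof -
    have "\<bar>u i\<bar> \<le> R" using x[of i] that by (auto simp: u_def I_def abs_mult abs_sgn_eq)
    then show "- R \<le> u i" "u i \<le> R" by auto
  qed (use that in \<open>simp add: I_def\<close>)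
  have h: "0 \<le> h i" "h i \<le> 1" if "i \<in> I" for i
    using u[OF that] by (auto simp: h_def divide_simps)
  have "t \<in> h ` I" unfolding t_def using I by (intro Min_in) auto
  then obtain j where j: "j \<in> I" "t = h j" by blast
  have t: "0 \<le> t" "t \<le> 1" using h[OF j(1)] j(2) by auto
  have abs_eq: "\<bar>(1 - t) * x i + t * z i\<bar> = \<bar>u i + t * (\<bar>z i\<bar> - u i)\<bar>" if "i \<in> I" for i
  proof -
    have "z i \<noteq> 0" using x[of i] that by (auto simp: I_def)
    then have "sgn (z i) * ((1 - t) * x i + t * z i) = u i + t * (\<bar>z i\<bar> - u i)"
      by (simp add: u_def algebra_simps abs_sgn)
    moreover have "\<bar>sgn (z i) * ((1 - t) * x i + t * z i)\<bar> = \<bar>(1 - t) * x i + t * z i\<bar>"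
      using \<open>z i \<noteq> 0\<close> by (simp add: abs_mult abs_sgn_eq)
    ultimately show ?thesis by simp
  qed
  show thesis
  proof
    show "0 \<le> t" "t \<le> 1" using t .
    show "\<bar>(1 - t) * x i + t * z i\<bar> \<le> R" if "i < d" for i
    proof (cases "i \<in> I")
      case True
      have "t \<le> h i" unfolding t_def using I True by (intro Min_le) auto
      then have "t * (\<bar>z i\<bar> - u i) \<le> h i * (\<bar>z i\<bar> - u i)" using u[OF True] by (intro mult_right_mono) auto
      also have "\<dots> = R - u i" using u[OF True] by (simp add: h_def)
      finally have "u i + t * (\<bar>z i\<bar> - u i) \<le> R" by simp
      moreover have "0 \<le> t * (\<bar>z i\<bar> - u i)" using t u[OF True] by (intro mult_nonneg_nonneg) auto
      then have "- R \<le> u i + t * (\<bar>z i\<bar> - u i)" using u[OF True] by linarith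
      ultimately show ?thesis unfolding abs_eq[OF True] by (simp add: abs_le_iff)
    next
      case False
      then have zi: "\<bar>z i\<bar> \<le> R" using that by (simp add: I_def)
      have "\<bar>(1 - t) * x i + t * z i\<bar> \<le> (1 - t) * \<bar>x i\<bar> + t * \<bar>z i\<bar>"
        using t abs_triangle_ineq[of "(1 - t) * x i" "t * z i"] by (simp add: abs_mult)
      also have "\<dots> \<le> (1 - t) * R + t * R" using t zi x[OF that] by (intro add_mono mult_left_mono) auto
      finally show ?thesis by (simp add: algebra_simps)
    qed
    show "j < d" using j(1) by (simp add: I_def)
    have "u j + t * (\<bar>z j\<bar> - u j) = R" using u[OF j(1)] by (simp add: j(2) h_def)
    moreover have "R \<ge> 0" using x[OF \<open>j < d\<close>] by linarith
    ultimately show "\<bar>(1 - t) * x j + t * z j\<bar> = R" unfolding abs_eq[OF j(1)] by simp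
  qed
qed

text \<open>If \<open>z\<close> lay outside the box, the segment from a point of \<open>ps\<close>
  to \<open>z\<close> would meet the boundary of the box in a point \<open>w\<close> satisfying all
  inequalities. Rounding \<open>w\<close> gives a boundary lattice point at which no inequality is
  violated by more than its safety margin.\<close>

lemma description_cert_sound:
  assumes cert: "description_cert d ps M A" and "ps \<noteq> []" "length z = d" "satisfies A z"
  shows "z \<in> set ps"
proof (cases "z \<in> set (lattice_box d M)")
  case True
  then show ?thesis using cert assms(4) unfolding description_cert_def by blast
next
  case False
  obtain p where p: "p \<in> set ps" using assms(2) by (cases ps) auto
  then have p': "length p = d" "\<And>t. t \<in> set p \<Longrightarrow> \<bar>t\<bar> \<le> int M" "satisfies A p"
    using cert by (auto simp: description_cert_def set_lattice_box)
  define x where "x = point_of p"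
  define y where "y = point_of z"
  have "\<bar>x i\<bar> \<le> real M" if "i < d" for i
  proof -
    have "\<bar>p ! i\<bar> \<le> int M" using p'(1,2) that by simp
    then have "real_of_int \<bar>p ! i\<bar> \<le> real_of_int (int M)" by (simp only: of_int_le_iff)
    then show ?thesis using p'(1) that by (simp add: x_def point_of_nth)
  qed
  moreover have "\<exists>i<d. \<bar>y i\<bar> > real M"
  proof -
    obtain i where i: "i < d" "int M < \<bar>z ! i\<bar>"
      using False assms(3) by (auto simp: set_lattice_box in_set_conv_nth not_le)
    then have "real_of_int (int M) < real_of_int \<bar>z ! i\<bar>" by (simp only: of_int_less_iff)
    then show ?thesis using i(1) assms(3) by (auto simp: y_def point_of_nth)
  qed
  ultimately obtain t j where t: "0 \<le> t" "t \<le> 1" "\<And>i. i < d \<Longrightarrow> \<bar>(1 - t) * x i + t * y i\<bar> \<le> real M"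
    and j: "j < d" "\<bar>(1 - t) * x j + t * y j\<bar> = real M"
    using segment_meets_box_boundary[of d x "real M" y] by metis
  define w where "w = (1 - t) *\<^sub>R x + t *\<^sub>R y"
  have w: "w i = (1 - t) * x i + t * y i" for i by (simp add: w_def scaleR_fun_def)
  \<comment> \<open>As \<open>M\<close> is an integer, rounding down stays in the box and does not
    move the coordinate \<open>j\<close>, which equals \<open>M\<close> or
    \<open>- M\<close>.\<close>
  define g where "g = map (\<lambda>i. \<lfloor>w i\<rfloor>) [0..<d]"
  have g: "length g = d" "\<And>i. i < d \<Longrightarrow> g ! i = \<lfloor>w i\<rfloor>" by (simp_all add: g_def)
  have "\<bar>g ! i\<bar> \<le> int M" if "i < d" for i
  proof -
    have "- real M \<le> w i" "w i \<le> real M" using t(3)[OF that] by (auto simp: w abs_le_iff)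
    then have "- int M \<le> \<lfloor>w i\<rfloor>" "\<lfloor>w i\<rfloor> \<le> int M" by (simp add: le_floor_iff, linarith)
    then show ?thesis using g(2)[OF that] by simp
  qed
  then have "g \<in> set (lattice_box d M)" using g(1) by (auto simp: set_lattice_box in_set_conv_nth)
  moreover have "\<not> (\<forall>t\<in>set g. \<bar>t\<bar> < int M)"
  proof -
    have "w j = of_int (int M) \<or> w j = of_int (- int M)" using j(2) by (auto simp: w)
    then have "\<bar>g ! j\<bar> = int M" using g(2)[OF j(1)] by (auto simp only: floor_of_int)
    moreover have "g ! j \<in> set g" using g(1) j(1) by simp
    ultimately show ?thesis by force
  qed
  ultimately obtain c where c: "c \<in> set A" "snd c + norm1 (fst c) < iprod (fst c) g"
    using cert unfolding description_cert_def by blast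
  define a where "a = point_of (fst c)"
  have "dotp d a x \<le> of_int (snd c)" "dotp d a y \<le> of_int (snd c)"
    using p'(1,3) assms(3,4) c(1) by (auto simp: a_def x_def y_def dotp_point_of satisfies_def)
  then have "dotp d a w \<le> (1 - t) * of_int (snd c) + t * of_int (snd c)"
    unfolding w_def dotp_add dotp_scaleR using t by (intro add_mono mult_left_mono) auto
  then have aw: "dotp d a w \<le> of_int (snd c)" by (simp add: algebra_simps)
  have "dotp d a (point_of g) \<le> (\<Sum>i<d. a i * w i + \<bar>a i\<bar>)"
    unfolding dotp_def
  proof (intro sum_mono)
    fix i assume "i \<in> {..<d}"
    then have "point_of g i = of_int \<lfloor>w i\<rfloor>" using g by (simp add: point_of_nth)
    then have "\<bar>point_of g i - w i\<bar> \<le> 1" by linarith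
    then have "\<bar>a i * (point_of g i - w i)\<bar> \<le> \<bar>a i\<bar> * 1" unfolding abs_mult by (intro mult_left_mono) auto
    then have "a i * (point_of g i - w i) \<le> \<bar>a i\<bar>" by simp
    then show "a i * point_of g i \<le> a i * w i + \<bar>a i\<bar>" by (simp add: algebra_simps)
  qed
  also have "\<dots> = dotp d a w + (\<Sum>i<d. \<bar>a i\<bar>)" by (simp add: dotp_def sum.distrib)
  also have "\<dots> \<le> of_int (snd c) + of_int (norm1 (fst c))"
    using aw sum_abs_point_of_le[where d = d and a = "fst c"] unfolding a_def by (rule add_mono)
  finally have "real_of_int (iprod (fst c) g) \<le> of_int (snd c + norm1 (fst c))"
    using dotp_point_of[OF g(1)] by (simp add: a_def)
  then have "iprod (fst c) g \<le> snd c + norm1 (fst c)" by (simp only: of_int_le_iff)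
  then show ?thesis using c(2) by simp
qed

lemma description_cert_complete:
  assumes ps: "ps \<noteq> []" "\<And>p. p \<in> set ps \<Longrightarrow> length p = d"
    and desc: "integrally_described d k (point_of ` set ps)"
  shows "\<exists>A M0. length A = k \<and> (\<forall>M\<ge>M0. description_cert d ps M A)"
proof -
  obtain A b where A: "\<And>i. i < k \<Longrightarrow> A i \<in> int_lattice d" "\<And>i. i < k \<Longrightarrow> b i \<in> \<int>"
    and X: "point_of ` set ps = {x \<in> int_lattice d. \<forall>i<k. dotp d (A i) x \<le> b i}"
    using desc unfolding integrally_described_def by blast
  have "\<forall>i. \<exists>a. i < k \<longrightarrow> length a = d \<and> A i = point_of a" using A(1) int_lattice_point_of by blast
  then obtain a where a: "\<And>i. i < k \<Longrightarrow> length (a i) = d" "\<And>i. i < k \<Longrightarrow> A i = point_of (a i)" by metis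
  define e where "e i = \<lfloor>b i\<rfloor>" for i
  have e: "b i = of_int (e i)" if "i < k" for i using A(2)[OF that] by (auto simp: e_def elim: Ints_cases)
  define L where "L = map (\<lambda>i. (a i, e i)) [0..<k]"
  have L: "(\<forall>c\<in>set L. P c) \<longleftrightarrow> (\<forall>i<k. P (a i, e i))" for P by (auto simp: L_def)
  have dotp_eq: "dotp d (A i) (point_of p) = of_int (iprod (a i) p)" if "length p = d" "i < k" for p i
    using a(2)[OF that(2)] dotp_point_of[OF that(1)] by simp
  have sat: "satisfies L p \<longleftrightarrow> p \<in> set ps" if "length p = d" for p
  proof -
    have "p \<in> set ps \<longleftrightarrow> point_of p \<in> point_of ` set ps"
      using ps(2) that point_of_eq_iff by (metis image_iff)
    also have "\<dots> \<longleftrightarrow> (\<forall>i<k. dotp d (A i) (point_of p) \<le> b i)"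
      unfolding X using point_of_in_int_lattice[OF that] by simp
    also have "\<dots> \<longleftrightarrow> satisfies L p" using dotp_eq[OF that] e by (auto simp: satisfies_def L)
    finally show ?thesis by simp
  qed
  \<comment> \<open>The solutions of the weakened system. They are precisely the points that must
    not lie on the boundary of the box.\<close>
  define Q where "Q = {x \<in> int_lattice d. \<forall>i\<in>{..<k}. dotp d (A i) x \<le> of_int (e i + norm1 (a i))}"
  have "{x \<in> int_lattice d. \<forall>i\<in>{..<k}. dotp d (A i) x \<le> b i} = point_of ` set ps"
    unfolding X by auto
  then have "finite {x \<in> int_lattice d. \<forall>i\<in>{..<k}. dotp d (A i) x \<le> b i}"
    "{x \<in> int_lattice d. \<forall>i\<in>{..<k}. dotp d (A i) x \<le> b i} \<noteq> {}"
    using ps(1) by simp_all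
  then have "finite Q" unfolding Q_def using A(1) by (intro finite_shifted_polyhedron[of "{..<k}" A d b]) auto
  then have "finite (Q \<union> point_of ` set ps)" by simp
  then obtain B where B: "\<And>x i. x \<in> Q \<union> point_of ` set ps \<Longrightarrow> i < d \<Longrightarrow> \<bar>x i\<bar> \<le> B"
    using finite_coord_bound by metis
  \<comment> \<open>The additional 1 makes the bound strict, so that these points avoid the
    boundary.\<close>
  define M0 where "M0 = nat \<lceil>B\<rceil> + 1"
  have small: "\<bar>t\<bar> < int M0"
    if len: "length p = d" and p: "point_of p \<in> Q \<union> point_of ` set ps" and t: "t \<in> set p" for p t
  proof -
    obtain i where "i < d" "t = p ! i" using len t by (auto simp: in_set_conv_nth)
    then have "real_of_int \<bar>t\<bar> \<le> B" using B[OF p, of i] len by (simp add: point_of_nth)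
    then show ?thesis unfolding M0_def by linarith
  qed
  have "description_cert d ps M L" if "M \<ge> M0" for M
    unfolding description_cert_def
  proof (intro conjI ballI)
    fix p assume p: "p \<in> set ps"
    show "satisfies L p" using sat p ps(2) by blast
    show "p \<in> set (lattice_box d M)"
      using small[of p] p ps(2)[OF p] that by (force simp: set_lattice_box)
  next
    fix g assume "g \<in> set (lattice_box d M)"
    then have g: "length g = d" by (simp add: set_lattice_box)
    show "g \<in> set ps \<or> \<not> satisfies L g" using sat[OF g] by blast
    show "(\<forall>t\<in>set g. \<bar>t\<bar> < int M) \<or> (\<exists>c\<in>set L. snd c + norm1 (fst c) < iprod (fst c) g)"
    proof (rule disjCI)
      assume *: "\<not> (\<exists>c\<in>set L. snd c + norm1 (fst c) < iprod (fst c) g)"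
      have "dotp d (A i) (point_of g) \<le> of_int (e i + norm1 (a i))" if "i < k" for i
      proof -
        have "(a i, e i) \<in> set L" using that by (auto simp: L_def)
        then have "iprod (a i) g \<le> e i + norm1 (a i)" using * by force
        then show ?thesis unfolding dotp_eq[OF g that] by (simp only: of_int_le_iff)
      qed
      then have "point_of g \<in> Q" using point_of_in_int_lattice[OF g] by (simp add: Q_def)
      then show "\<forall>t\<in>set g. \<bar>t\<bar> < int M" using small[OF g] that by force
    qed
  qed
  moreover have "length L = k" by (simp add: L_def)
  ultimately show ?thesis by blast
qed

text \<open>\<open>Z\<close> lists pairs of points with vanishing sum of differences; such a list shows that its second
  components cannot be separated from \<open>X\<close>. The box \<open>lattice_box d 1\<close> merely serves as a set of
  linear forms that contains the coordinates.\<close>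

definition zero_sum :: "nat \<Rightarrow> (int list \<times> int list) list \<Rightarrow> bool"
  where "zero_sum d L \<longleftrightarrow>
    (\<forall>e\<in>set (lattice_box d 1). (\<Sum>l\<leftarrow>L. iprod e (snd l) - iprod e (fst l)) = 0)"

text \<open>A colouring is listed as its graph, so that colour classes can be tested by list
  membership.\<close>

definition colorings :: "nat \<Rightarrow> 'a list \<Rightarrow> ('a \<times> nat) list list"
  where "colorings k ys = product_lists (map (\<lambda>y. map (Pair y) [0..<k]) ys)"

definition lower_bound_cert ::
    "nat \<Rightarrow> int list list \<Rightarrow> nat \<Rightarrow> nat \<Rightarrow> (int list \<times> int list) list list \<Rightarrow> bool"
  where "lower_bound_cert d ps M k Z \<longleftrightarrow> (\<forall>col\<in>set (colorings k (filter (\<lambda>y. y \<notin> set ps) (lattice_box d M))).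
    \<exists>L\<in>set Z. L \<noteq> [] \<and> zero_sum d L \<and> (\<forall>l\<in>set L. fst l \<in> set ps) \<and>
      (\<exists>j\<in>set [0..<k]. \<forall>l\<in>set L. (snd l, j) \<in> set col))"

lemma zero_sum_iff:
  assumes "\<And>l. l \<in> set L \<Longrightarrow> length (fst l) = d \<and> length (snd l) = d"
  shows "zero_sum d L \<longleftrightarrow> (\<Sum>l\<leftarrow>L. point_of (snd l) - point_of (fst l)) = 0"
proof -
  define S where "S = (\<Sum>l\<leftarrow>L. point_of (snd l) - point_of (fst l))"
  have key: "of_int (\<Sum>l\<leftarrow>L. iprod e (snd l) - iprod e (fst l)) = dotp d (point_of e) S" for e
    unfolding S_def using assms
  proof (induction L)
    case (Cons l L)
    have "dotp d (point_of e) (point_of (snd l) - point_of (fst l)) = of_int (iprod e (snd l) - iprod e (fst l))"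
      using Cons.prems[of l] by (simp add: dotp_diff dotp_point_of)
    moreover have "of_int (\<Sum>l\<leftarrow>L. iprod e (snd l) - iprod e (fst l)) =
        dotp d (point_of e) (\<Sum>l\<leftarrow>L. point_of (snd l) - point_of (fst l))"
      by (rule Cons.IH) (use Cons.prems in auto)
    ultimately show ?case by (simp only: list.map sum_list.Cons of_int_add dotp_add)
  qed (simp only: list.map sum_list.Nil dotp_zero of_int_0)
  have "S = 0" if zero: "zero_sum d L"
  proof
    fix i
    show "S i = 0 i"
    proof (cases "i < d")
      case True
      define e where "e = (replicate d 0)[i := (1::int)]"
      have "set e \<subseteq> {0, 1}" unfolding e_def by (auto dest: set_update_subset_insert[THEN subsetD])
      moreover have "length e = d" by (simp add: e_def)
      ultimately have "e \<in> set (lattice_box d 1)" by (auto simp: set_lattice_box)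
      then have "dotp d (point_of e) S = 0" using zero key[of e] by (simp add: zero_sum_def)
      moreover have "dotp d (point_of e) S = (\<Sum>k<d. if k = i then S k else 0)"
        unfolding dotp_def by (intro sum.cong) (auto simp: point_of_def e_def nth_list_update)
      ultimately show ?thesis using True by simp
    next
      case False
      have "(\<Sum>l\<leftarrow>L. point_of (snd l) - point_of (fst l)) i = 0"
        using assms False by (induction L) (auto simp: point_of_def)
      then show ?thesis by (simp add: S_def)
    qed
  qed
  moreover have "zero_sum d L" if "S = 0"
    unfolding zero_sum_def
  proof
    fix e assume "e \<in> set (lattice_box d 1)"
    have "real_of_int (\<Sum>l\<leftarrow>L. iprod e (snd l) - iprod e (fst l)) = 0"
      unfolding key that by (rule dotp_zero)
    then show "(\<Sum>l\<leftarrow>L. iprod e (snd l) - iprod e (fst l)) = 0" by (simp only: of_int_eq_0_iff)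
  qed
  ultimately show ?thesis unfolding S_def by blast
qed

lemma mem_set_colorings:
  "cs \<in> set (colorings k ys) \<longleftrightarrow>
    length cs = length ys \<and> (\<forall>i<length ys. \<exists>j<k. cs ! i = (ys ! i, j))"
  by (auto simp: colorings_def product_lists_set list_all2_conv_all_nth image_iff Bex_def)

lemma lower_bound_cert_sound:
  assumes cert: "lower_bound_cert d ps M k Z" and ps: "\<And>p. p \<in> set ps \<Longrightarrow> length p = d"
  shows "\<not> separation_colorable d k (point_of ` set ps)
    (point_of ` set (filter (\<lambda>y. y \<notin> set ps) (lattice_box d M)))"
proof
  define ys where "ys = filter (\<lambda>y. y \<notin> set ps) (lattice_box d M)"
  assume "separation_colorable d k (point_of ` set ps) (point_of ` set (filter (\<lambda>y. y \<notin> set ps) (lattice_box d M)))"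
  then obtain c where c: "\<And>y. y \<in> set ys \<Longrightarrow> c (point_of y) < k"
    and sep: "\<And>j. j < k \<Longrightarrow> separable d (point_of ` set ps) {y\<in>point_of ` set ys. c y = j}"
    by (auto simp: separation_colorable_def ys_def)
  define col where "col = map (\<lambda>y. (y, c (point_of y))) ys"
  have "col \<in> set (colorings k ys)" using c by (simp add: mem_set_colorings col_def)
  then obtain L j where L: "L \<noteq> []" "zero_sum d L" "\<And>l. l \<in> set L \<Longrightarrow> fst l \<in> set ps"
    and j: "j < k" "\<And>l. l \<in> set L \<Longrightarrow> (snd l, j) \<in> set col"
    using cert unfolding lower_bound_cert_def ys_def[symmetric] by fastforce
  have snd_L: "snd l \<in> set ys" "c (point_of (snd l)) = j" if "l \<in> set L" for l
    using j(2)[OF that] by (auto simp: col_def)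
  have len: "length (fst l) = d \<and> length (snd l) = d" if "l \<in> set L" for l
    using ps[OF L(3)[OF that]] snd_L(1)[OF that] by (simp add: ys_def set_lattice_box)
  obtain a where a: "\<And>x y. x \<in> point_of ` set ps \<Longrightarrow> y \<in> {y\<in>point_of ` set ys. c y = j} \<Longrightarrow> dotp d a x < dotp d a y"
    using sep[OF j(1)] unfolding separable_def by blast
  show False
  proof (rule zero_sum_not_separated[OF _ _ _ a])
    let ?K = "map (\<lambda>l. (point_of (fst l), point_of (snd l))) L"
    show "?K \<noteq> []" using L(1) by simp
    show "set ?K \<subseteq> point_of ` set ps \<times> {y\<in>point_of ` set ys. c y = j}" using L(3) snd_L by auto
    show "(\<Sum>(x, y)\<leftarrow>?K. y - x) = 0" using zero_sum_iff[OF len] L(2) by (simp add: comp_def)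
  qed
qed

text \<open>Every colouring has a colour class that cannot be separated from the given points, and
  the integral alternative supplies a zero-sum list for it. One list is collected for each of the
  finitely many colourings.\<close>

lemma lower_bound_cert_complete:
  assumes ps: "\<And>p. p \<in> set ps \<Longrightarrow> length p = d"
    and "\<not> separation_colorable d k (point_of ` set ps)
      (point_of ` set (filter (\<lambda>y. y \<notin> set ps) (lattice_box d M)))"
  shows "\<exists>Z. lower_bound_cert d ps M k Z"
proof -
  define ys where "ys = filter (\<lambda>y. y \<notin> set ps) (lattice_box d M)"
  have ys: "length y = d" if "y \<in> set ys" for y using that by (simp add: ys_def set_lattice_box)
  define good where "good col L \<longleftrightarrow> L \<noteq> [] \<and> zero_sum d L \<and> (\<forall>l\<in>set L. fst l \<in> set ps) \<and>
      (\<exists>j\<in>set [0..<k]. \<forall>l\<in>set L. (snd l, j) \<in> set col)" for col and L :: "(int list \<times> int list) list"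
  have "\<exists>L. good col L" if col: "col \<in> set (colorings k ys)" for col
  proof -
    have "\<exists>j<k. (y, j) \<in> set col" if "y \<in> set ys" for y
    proof -
      obtain i where "i < length ys" "y = ys ! i" using \<open>y \<in> set ys\<close> by (auto simp: in_set_conv_nth)
      then show ?thesis using col unfolding mem_set_colorings by (metis nth_mem)
    qed
    then obtain f where f: "\<And>y. y \<in> set ys \<Longrightarrow> f y < k" "\<And>y. y \<in> set ys \<Longrightarrow> (y, f y) \<in> set col" by metis
    \<comment> \<open>The colouring lives on integer lists and is transported to points; this works
      because \<open>point_of\<close> is injective on lists of equal length.\<close>
    define c where "c x = f (inv_into (set ys) point_of x)" for x
    have "inj_on point_of (set ys)"
      using ys by (intro inj_onI) (simp add: point_of_eq_iff)
    then have c: "c (point_of y) = f y" if "y \<in> set ys" for y using that by (simp add: c_def inv_into_f_f)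
    have "\<forall>y\<in>point_of ` set ys. c y < k" using c f(1) by simp
    then obtain j where j: "j < k" "\<not> separable d (point_of ` set ps) {y\<in>point_of ` set ys. c y = j}"
      using assms(2) unfolding separation_colorable_def ys_def[symmetric] by blast
    have "{y\<in>point_of ` set ys. c y = j} = point_of ` {y\<in>set ys. f y = j}" using c by auto
    moreover have "point_of ` set ps \<subseteq> int_lattice d" "point_of ` {y\<in>set ys. f y = j} \<subseteq> int_lattice d"
      using ps ys by (auto intro!: point_of_in_int_lattice)
    ultimately obtain K where K: "K \<noteq> []" "set K \<subseteq> point_of ` set ps \<times> point_of ` {y\<in>set ys. f y = j}"
      "(\<Sum>(x, y)\<leftarrow>K. y - x) = 0"
      using integral_separation[of "point_of ` set ps" "point_of ` {y\<in>set ys. f y = j}" d] j(2)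
      unfolding separable_def by auto
    define h where "h = (\<lambda>l. (point_of (fst l), point_of (snd l)))"
    have "K \<in> lists (h ` (set ps \<times> {y\<in>set ys. f y = j}))"
      using K(2) by (force simp: in_lists_conv_set h_def)
    then obtain L where L: "K = map h L" "set L \<subseteq> set ps \<times> {y\<in>set ys. f y = j}"
      by (auto simp: lists_image in_lists_conv_set)
    have "length (fst l) = d \<and> length (snd l) = d" if "l \<in> set L" for l
      using that L(2) ps ys by auto
    then have "zero_sum d L" using zero_sum_iff K(3) L(1) by (simp add: h_def comp_def)
    moreover have "L \<noteq> []" using K(1) L(1) by simp
    moreover have "\<forall>l\<in>set L. fst l \<in> set ps" "\<forall>l\<in>set L. (snd l, j) \<in> set col" using L(2) f(2) by auto
    ultimately show ?thesis unfolding good_def using j(1) by (intro exI[of _ L]) auto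
  qed
  then obtain F where F: "\<And>col. col \<in> set (colorings k ys) \<Longrightarrow> good col (F col)" by metis
  have "lower_bound_cert d ps M k (map F (colorings k ys))"
    unfolding lower_bound_cert_def ys_def[symmetric]
  proof
    fix col assume "col \<in> set (colorings k ys)"
    then show "\<exists>L\<in>set (map F (colorings k ys)). L \<noteq> [] \<and> zero_sum d L \<and> (\<forall>l\<in>set L. fst l \<in> set ps) \<and>
      (\<exists>j\<in>set [0..<k]. \<forall>l\<in>set L. (snd l, j) \<in> set col)"
      using F[of col] unfolding good_def set_map by blast
  qed
  then show ?thesis by blast
qed

section \<open>The certificate check: decidability, completeness and soundness\<close>

type_synonym cert =
  "nat \<times> (int list \<times> int) list \<times> nat \<times> (int list \<times> int list) list list"

text \<open>The components of a certificate are the claimed complexity, the inequalities, the size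
  of the box and the zero-sum lists. The lower bound refutes one colour less than claimed; the claim
  0 needs no refutation, and there the truncated subtraction would be misleading.\<close>

definition cert_ok :: "nat \<times> int list list \<Rightarrow> cert \<Rightarrow> bool"
  where "cert_ok x c \<longleftrightarrow>
    length (fst (snd c)) = fst c \<and>
    description_cert (fst x) (snd x) (fst (snd (snd c))) (fst (snd c)) \<and>
    (fst c = 0 \<or> lower_bound_cert (fst x) (snd x) (fst (snd (snd c))) (fst c - 1) (snd (snd (snd c))))"

lemma computable_zip [computable_intros]:
  fixes f :: "'a::enc \<Rightarrow> 'b::enc list" and g :: "'a \<Rightarrow> 'c::enc list"
  assumes "computable f" "computable g"
  shows "computable (\<lambda>x. zip (f x) (g x))"
proof -
  define step where "step x s = (case fst s of [] \<Rightarrow> s | y # ys \<Rightarrow> (ys, (x, y) # snd s))"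
    for x :: 'b and s :: "'c list \<times> ('b \<times> 'c) list"
  have Nil: "fold step xs ([], zs) = ([], zs)" for xs zs
    by (induction xs) (simp_all add: step_def)
  have "snd (fold step xs (ys, zs)) = rev (zip xs ys) @ zs" for xs ys zs
  proof (induction xs arbitrary: ys zs)
    case (Cons x xs)
    then show ?case by (cases ys) (simp_all add: step_def Nil[unfolded step_def])
  qed simp
  then have "zip xs ys = rev (snd (fold step xs (ys, [])))" for xs ys by simp
  moreover have "computable (\<lambda>x. rev (snd (fold (\<lambda>y s. step y s) (f x) (g x, []))))"
    unfolding step_def by (intro computable_intros assms)
  ultimately show ?thesis by simp
qed

lemma computable_iprod [computable_intros]: "computable f \<Longrightarrow> computable g \<Longrightarrow> computable (\<lambda>x. iprod (f x) (g x))"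
  unfolding iprod_def by (intro computable_intros)

lemma computable_norm1 [computable_intros]: "computable f \<Longrightarrow> computable (\<lambda>x. norm1 (f x))"
  unfolding norm1_def by (intro computable_intros)

lemma computable_lattice_box [computable_intros]: "computable f \<Longrightarrow> computable g \<Longrightarrow> computable (\<lambda>x. lattice_box (f x) (g x))"
  unfolding lattice_box_def by (intro computable_intros computable_compose[of g fst for g])

text \<open>Every quantifier of the check ranges over a computed list. This is the reason for forms
  such as \<open>set [0..<k]\<close> in the definitions.\<close>

lemma computable_cert_ok: "decidable (\<lambda>z. cert_ok (fst z) (snd z))"
  unfolding cert_ok_def description_cert_def lower_bound_cert_def satisfies_def zero_sum_def colorings_def
  by (intro computable_intros)

lemma Inf_enat_Collect:
  assumes "P k" "\<And>l. P l \<Longrightarrow> k \<le> l"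
  shows "Inf {enat n | n. P n} = enat k"
  using assms by (intro antisym Inf_lower Inf_greatest) auto

text \<open>A real description colours the observers, such a colouring gives an integral description
  with the same number of inequalities, and this one is rational and real. So all kinds of
  description have the same minimum.\<close>

lemma relaxation_complexity_attained:
  assumes "finite X" "X \<noteq> {}" "lattice_convex d X" "nondegenerate d X" "finite (observers d X)"
  obtains k where "integrally_described d k X" "\<And>l. described_by UNIV d l X \<Longrightarrow> k \<le> l"
    "rc d X = enat k" "rc_rat d X = enat k"
proof -
  have obs: "observers d X \<subseteq> int_lattice d - X" by (auto simp: observers_def)
  have imp: "integrally_described d l X" if "described_by UNIV d l X" for l
    using described_imp_colorable[OF that assms(4,1,2,5) obs] assms(1-3)
    by (rule colorable_imp_integrally_described) simp
  have desc: "described_by \<rat> d l X" "described_by UNIV d l X" if "integrally_described d l X" for l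
    using integrally_described_imp_described[OF that] described_by_mono[OF _ subset_UNIV] by blast+
  have "\<exists>l. integrally_described d l X"
    using observers_colorable[OF assms(1,3,5)] colorable_imp_integrally_described[OF _ assms(1-3)] by blast
  then obtain k where k: "integrally_described d k X" "\<And>l. integrally_described d l X \<Longrightarrow> k \<le> l"
    using LeastI_ex[of "\<lambda>l. integrally_described d l X"] Least_le[of "\<lambda>l. integrally_described d l X"] by blast
  show thesis
  proof
    show "integrally_described d k X" by (rule k)
    show *: "k \<le> l" if "described_by UNIV d l X" for l using k(2) imp that by blast
    show "rc d X = enat k" unfolding rc_def
      using desc(2)[OF k(1)] * by (rule Inf_enat_Collect)
    show "rc_rat d X = enat k" unfolding rc_rat_def
      using desc(1)[OF k(1)] * described_by_mono[OF _ subset_UNIV] by (intro Inf_enat_Collect) blast+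
  qed
qed

lemma cert_ok_complete:
  assumes "finite X" "X \<noteq> {}" "lattice_convex d X" "nondegenerate d X" "finite (observers d X)"
    and "lists_points d ps X"
  shows "\<exists>c. cert_ok (d, ps) c"
proof -
  obtain k where k: "integrally_described d k X" "\<And>l. described_by UNIV d l X \<Longrightarrow> k \<le> l"
    using relaxation_complexity_attained[OF assms(1-5)] by metis
  have X: "X = point_of ` set ps" and ps: "\<And>p. p \<in> set ps \<Longrightarrow> length p = d"
    using assms(6) by (auto simp: lists_points_def)
  have "ps \<noteq> []" using X assms(2) by auto
  then obtain A M0 where A: "length A = k" "\<And>M. M \<ge> M0 \<Longrightarrow> description_cert d ps M A"
    using description_cert_complete[OF _ ps] k(1) unfolding X by blast
  obtain B where B: "\<And>x i. x \<in> observers d X \<Longrightarrow> i < d \<Longrightarrow> \<bar>x i\<bar> \<le> B"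
    using finite_coord_bound[OF assms(5)] by metis
  \<comment> \<open>Large enough for the description and for the box to contain all observers. A
    colouring of the box with fewer colours would then also separate the observers and produce a
    shorter description.\<close>
  define M where "M = max M0 (nat \<lceil>B\<rceil>)"
  define ys where "ys = filter (\<lambda>y. y \<notin> set ps) (lattice_box d M)"
  have obs: "observers d X \<subseteq> point_of ` set ys"
  proof
    fix z assume z: "z \<in> observers d X"
    then obtain p where p: "length p = d" "z = point_of p"
      using int_lattice_point_of unfolding observers_def by blast
    have "\<bar>t\<bar> \<le> int M" if t: "t \<in> set p" for t
    proof -
      obtain i where "i < d" "t = p ! i" using p(1) t by (auto simp: in_set_conv_nth)
      then have "real_of_int \<bar>t\<bar> \<le> B" using B[OF z, of i] p by (simp add: point_of_nth)
      then show ?thesis unfolding M_def by linarith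
    qed
    moreover have "p \<notin> set ps" using z p(2) unfolding observers_def X by blast
    ultimately show "z \<in> point_of ` set ys" using p by (simp add: ys_def set_lattice_box)
  qed
  have "\<exists>Z. k = 0 \<or> lower_bound_cert d ps M (k - 1) Z"
  proof (cases "k = 0")
    case False
    have "\<not> separation_colorable d (k - 1) X (point_of ` set ys)"
    proof
      assume "separation_colorable d (k - 1) X (point_of ` set ys)"
      then have "integrally_described d (k - 1) X"
        using assms(1-3) obs by (rule colorable_imp_integrally_described)
      then have "described_by UNIV d (k - 1) X"
        using integrally_described_imp_described described_by_mono by blast
      then show False using k(2) False by fastforce
    qed
    then show ?thesis using lower_bound_cert_complete[OF ps] unfolding X ys_def by blast
  qed simp
  then obtain Z where "k = 0 \<or> lower_bound_cert d ps M (k - 1) Z" by blast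
  moreover have "description_cert d ps M A" using A(2) by (simp add: M_def)
  ultimately have "cert_ok (d, ps) (k, A, M, Z)" using A(1) by (simp add: cert_ok_def)
  then show ?thesis by blast
qed

text \<open>The size of the box is not controlled here: a description with fewer inequalities than
  claimed would colour every finite set of lattice points outside \<open>X\<close>, in particular
  those of whatever box the certificate names.\<close>

lemma cert_ok_sound:
  assumes "finite X" "X \<noteq> {}" "lattice_convex d X" "nondegenerate d X" "finite (observers d X)"
    and "lists_points d ps X" and cert: "cert_ok (d, ps) c"
  shows "rc d X = enat (fst c)"
proof -
  obtain k where k: "integrally_described d k X" "\<And>l. described_by UNIV d l X \<Longrightarrow> k \<le> l" "rc d X = enat k"
    using relaxation_complexity_attained[OF assms(1-5)] by metis
  obtain l A M Z where c: "c = (l, A, M, Z)" by (metis prod.exhaust)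
  have A: "length A = l" "description_cert d ps M A" "l = 0 \<or> lower_bound_cert d ps M (l - 1) Z"
    using cert by (auto simp: cert_ok_def c)
  have X: "X = point_of ` set ps" and ps: "\<And>p. p \<in> set ps \<Longrightarrow> length p = d"
    using assms(6) by (auto simp: lists_points_def)
  have ne: "ps \<noteq> []" using X assms(2) by auto
  have sat: "satisfies A p \<longleftrightarrow> p \<in> set ps" if "length p = d" for p
    using description_cert_sound[OF A(2) ne that] A(2) by (auto simp: description_cert_def)
  have "X = {x \<in> int_lattice d. \<forall>i<l. dotp d (point_of (fst (A ! i))) x \<le> of_int (snd (A ! i))}"
    (is "X = ?P")
  proof -
    have *: "x \<in> X \<longleftrightarrow> x \<in> ?P" if "x \<in> int_lattice d" for x
    proof -
      obtain p where p: "length p = d" "x = point_of p" using int_lattice_point_of[OF \<open>x \<in> int_lattice d\<close>] by blast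
      have "x \<in> X \<longleftrightarrow> p \<in> set ps" unfolding X p(2) using ps p(1) point_of_eq_iff by (metis image_iff)
      also have "\<dots> \<longleftrightarrow> satisfies A p" using sat[OF p(1)] by simp
      also have "\<dots> \<longleftrightarrow> x \<in> ?P"
        using that A(1) by (auto simp: satisfies_def p(2) dotp_point_of[OF p(1)] all_set_conv_all_nth)
      finally show ?thesis .
    qed
    moreover have "X \<subseteq> int_lattice d" using assms(3) by (auto simp: lattice_convex_def)
    ultimately show ?thesis by blast
  qed
  then have "described_by UNIV d l X" unfolding described_by_def
    by (intro exI[of _ "0::nat"] exI[of _ "\<lambda>i. point_of (fst (A ! i))"] exI[of _ "\<lambda>i. of_int (snd (A ! i))"]) simp
  then have "k \<le> l" by (rule k(2))
  moreover have "\<not> k < l"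
  proof
    assume "k < l"
    define ys where "ys = filter (\<lambda>y. y \<notin> set ps) (lattice_box d M)"
    have "described_by UNIV d k X"
      using integrally_described_imp_described[OF k(1)] described_by_mono by blast
    have "point_of ` set ys \<subseteq> int_lattice d - X"
    proof -
      have "point_of y \<in> int_lattice d - X" if "y \<in> set ys" for y
      proof -
        have y: "length y = d" "y \<notin> set ps" using that by (auto simp: ys_def set_lattice_box)
        then have "point_of y \<noteq> point_of p" if "p \<in> set ps" for p
          using that ps[OF that] point_of_eq_iff[of y p] by auto
        then show ?thesis unfolding X using point_of_in_int_lattice[OF y(1)] by blast
      qed
      then show ?thesis by blast
    qed
    note sub = this
    from \<open>described_by UNIV d k X\<close> have "separation_colorable d k X (point_of ` set ys)"
      using assms(4,1,2) finite_imageI[OF finite_set] sub by (rule described_imp_colorable)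
    then have "separation_colorable d (l - 1) X (point_of ` set ys)"
      by (rule separation_colorable_mono) (use \<open>k < l\<close> in simp)
    moreover have "lower_bound_cert d ps M (l - 1) Z" using A(3) \<open>k < l\<close> by simp
    ultimately show False using lower_bound_cert_sound[OF _ ps] unfolding X ys_def by blast
  qed
  ultimately show ?thesis using k(3) by (simp add: c)
qed

section \<open>The three conditions combined, and the algorithm\<close>

lemma nondegenerate_finite_observers:
  assumes "finite X" "lattice_convex d X"
    and "parity_complete d X \<or> has_interior_lattice_point d X \<or> wider_than_threshold d X"
  shows "X \<noteq> {} \<and> nondegenerate d X \<and> finite (observers d X)"
proof -
  have Xl: "X \<subseteq> int_lattice d" using assms(2) by (auto simp: lattice_convex_def)
  have "(0 :: point) \<in> int_lattice d" by (simp add: int_lattice_iff)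
  then have "X \<noteq> {}" if "parity_complete d X" using that by (auto simp: parity_complete_def)
  moreover have "X \<noteq> {}" if "has_interior_lattice_point d X"
    using that by (auto simp: has_interior_lattice_point_def)
  moreover have "X \<noteq> {}" if "wider_than_threshold d X"
    using that by (simp add: wider_than_threshold_def)
  ultimately have "X \<noteq> {}" using assms(3) by blast
  then show ?thesis
    using assms(3) parity_nondegenerate[OF assms(1) Xl] parity_finite_observers[OF assms(1) Xl]
      interior_nondegenerate[OF Xl] interior_finite_observers[OF assms(1) Xl]
      wide_nondegenerate[OF assms(1) Xl] wide_finite_observers[OF assms(1) Xl] by blast
qed

theorem theorem1p4:
  shows "\<exists>alg. \<forall>d X.
    finite X \<and> lattice_convex d X \<and>
    (parity_complete d X \<or> has_interior_lattice_point d X \<or> wider_than_threshold d X) \<longrightarrow>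
      rc d X = rc_rat d X \<and>
      (\<forall>ps. lists_points d ps X \<longrightarrow>
        (\<exists>k. run alg [encode_input d ps] = Some k \<and> rc d X = enat k))"
proof -
  have "computable (fst :: cert \<Rightarrow> nat)" by (intro computable_fst computable_id)
  then obtain alg where alg: "\<And>x. \<exists>c. cert_ok x c \<Longrightarrow> \<exists>c. cert_ok x c \<and> run alg [enc x] = Some (fst c)"
    using run_search[OF computable_cert_ok] by blast
  show ?thesis
  proof (intro exI[of _ alg] allI impI conjI)
    fix d X
    assume X: "finite X \<and> lattice_convex d X \<and>
      (parity_complete d X \<or> has_interior_lattice_point d X \<or> wider_than_threshold d X)"
    then have *: "finite X" "X \<noteq> {}" "lattice_convex d X" "nondegenerate d X" "finite (observers d X)"
      using nondegenerate_finite_observers by blast+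
    then show "rc d X = rc_rat d X" using relaxation_complexity_attained by metis
    fix ps assume ps: "lists_points d ps X"
    obtain c where "cert_ok (d, ps) c" "run alg [enc (d, ps)] = Some (fst c)"
      using alg cert_ok_complete[OF * ps] by blast
    then show "\<exists>k. run alg [encode_input d ps] = Some k \<and> rc d X = enat k"
      using cert_ok_sound[OF * ps] unfolding encode_input_eq_enc by blast
  qed
qed

end
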